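(* There are no more than $124$ pairwise non-isomorphic groups among the groups $G(A)$, where $A$ ranges over all invertible automata with $3$ states over a $2$-letter alphabet. That is, the groups generated by invertible $3$-state automata over a $2$-letter alphabet fall into at most $124$ isomorphism classes of abstract groups.
   Context: A finite invertible automaton is a quadruple $A=(Q,X,\tau,\rho)$ where $Q$ is a finite set of states, $X$ is a finite alphabet, $\tau:Q\times X\to Q$ (transition map) and $\rho:Q\times X\to X$ (output map) are maps such that for each $q\in Q$ the map $\rho_q:X\to X$, $\rho_q(x)=\rho(q,x)$, is a permutation of $X$. Each state $q$ defines an automorphism, also denoted $q$, of the regular rooted tree $X^*$ of finite words over $X$, recursively by $q(\emptyset)=\emptyset$ and $q(xw)=\rho_q(x)\,\tau(q,x)(w)$ for $x\in X$, $w\in X^*$. The automaton group $G(A)$ is the subgroup of $\mathrm{Aut}(X^* )$ generated by the automorphisms defined by the states of $A$. Here $|Q|=3$ and $|X|=2$; distinct states are allowed to define the same automorphism. *)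

theory Defs
  imports "HOL-Algebra.Bij" "HOL-Algebra.Generated_Groups"
begin

record ('q, 'x) automaton =
  states :: "'q set"
  alphabet :: "'x set"
  transition_fun :: "'q \<Rightarrow> 'x \<Rightarrow> 'q"
  output_fun :: "'q \<Rightarrow> 'x \<Rightarrow> 'x"

(* The values of transition_fun and output_fun outside states \<times> alphabet are unconstrained and play no role. *)
definition invertible_automaton :: "('q, 'x) automaton \<Rightarrow> bool" where
  "invertible_automaton A \<longleftrightarrow>
     finite (states A) \<and> finite (alphabet A) \<and>
     (\<forall>q\<in>states A. \<forall>x\<in>alphabet A. transition_fun A q x \<in> states A) \<and>
     (\<forall>q\<in>states A. bij_betw (output_fun A q) (alphabet A) (alphabet A))"

(* lists X is the set of finite words over X, i.e. the vertex set of the rooted tree X^*;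
   the root is [] and the children of u are the words u @ [x]. *)
definition child :: "'x list \<Rightarrow> 'x list \<Rightarrow> bool" where
  "child u v \<longleftrightarrow> (\<exists>x. v = u @ [x])"

definition tree_automorphisms :: "'x set \<Rightarrow> ('x list \<Rightarrow> 'x list) set" where
  "tree_automorphisms X =
     {f \<in> Bij (lists X). f [] = [] \<and>
        (\<forall>u\<in>lists X. \<forall>v\<in>lists X. child (f u) (f v) \<longleftrightarrow> child u v)}"

(* Multiplication, inherited from BijGroup, is composition: f \<otimes> g applies g first. *)
definition tree_aut_group :: "'x set \<Rightarrow> ('x list \<Rightarrow> 'x list) monoid" where
  "tree_aut_group X = (BijGroup (lists X))\<lparr>carrier := tree_automorphisms X\<rparr>"

primrec act :: "('q, 'x) automaton \<Rightarrow> 'q \<Rightarrow> 'x list \<Rightarrow> 'x list" where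
  "act A q [] = []"
| "act A q (x # w) = output_fun A q x # act A (transition_fun A q x) w"

definition state_aut :: "('q, 'x) automaton \<Rightarrow> 'q \<Rightarrow> 'x list \<Rightarrow> 'x list" where
  "state_aut A q = restrict (act A q) (lists (alphabet A))"

(* subgroup_generated G S uses only the generators in carrier G; by state_aut_closed below
   nothing is lost for an invertible automaton. *)
definition automaton_group :: "('q, 'x) automaton \<Rightarrow> ('x list \<Rightarrow> 'x list) monoid" where
  "automaton_group A =
     subgroup_generated (tree_aut_group (alphabet A)) (state_aut A ` states A)"

definition iso_rel :: "('a, 'm) monoid_scheme set \<Rightarrow> (('a, 'm) monoid_scheme \<times> ('a, 'm) monoid_scheme) set" where
  "iso_rel S = {(G, H). G \<in> S \<and> H \<in> S \<and> G \<cong> H}"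

definition iso_classes :: "('a, 'm) monoid_scheme set \<Rightarrow> ('a, 'm) monoid_scheme set set" where
  "iso_classes S = S // iso_rel S"

lemma subgroup_tree_automorphisms: "subgroup (tree_automorphisms X) (BijGroup (lists X))"
proof -
  interpret G: group "BijGroup (lists X)" by (rule group_BijGroup)
  show ?thesis
  proof (rule G.subgroupI)
    show "tree_automorphisms X \<subseteq> carrier (BijGroup (lists X))"
      by (auto simp: tree_automorphisms_def BijGroup_def)
    have "(\<lambda>x\<in>lists X. x) \<in> tree_automorphisms X"
      using id_Bij[of "lists X"] by (simp add: tree_automorphisms_def)
    then show "tree_automorphisms X \<noteq> {}" by blast
  next
    fix f assume f: "f \<in> tree_automorphisms X"
    then have fB: "f \<in> Bij (lists X)" and f0: "f [] = []" and
      fc: "\<And>u v. u \<in> lists X \<Longrightarrow> v \<in> lists X \<Longrightarrow> child (f u) (f v) \<longleftrightarrow> child u v"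
      by (auto simp: tree_automorphisms_def)
    let ?g = "\<lambda>x\<in>lists X. inv_into (lists X) f x"
    have inv: "inv\<^bsub>BijGroup (lists X)\<^esub> f = ?g" using fB by (rule inv_BijGroup)
    have bij: "bij_betw f (lists X) (lists X)" using fB by (simp add: Bij_def)
    have fg: "f (inv_into (lists X) f u) = u" if "u \<in> lists X" for u
      using bij that by (rule bij_betw_inv_into_right)
    have gm: "inv_into (lists X) f u \<in> lists X" if "u \<in> lists X" for u
      using fB that by (rule Bij_inv_into_mem)
    have "?g \<in> Bij (lists X)" using fB by (rule restrict_inv_into_Bij)
    moreover have "?g [] = []"
      using bij_betw_inv_into_left[OF bij, of "[]"] f0 by simp
    moreover have "child (?g u) (?g v) \<longleftrightarrow> child u v" if "u \<in> lists X" "v \<in> lists X" for u v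
      using fc[OF gm[OF that(1)] gm[OF that(2)]] fg that by simp
    ultimately show "inv\<^bsub>BijGroup (lists X)\<^esub> f \<in> tree_automorphisms X"
      unfolding inv tree_automorphisms_def by blast
  next
    fix f g assume "f \<in> tree_automorphisms X" "g \<in> tree_automorphisms X"
    then have fB: "f \<in> Bij (lists X)" and gB: "g \<in> Bij (lists X)" and f0: "f [] = []" "g [] = []" and
      fc: "\<And>u v. u \<in> lists X \<Longrightarrow> v \<in> lists X \<Longrightarrow> child (f u) (f v) \<longleftrightarrow> child u v" and
      gc: "\<And>u v. u \<in> lists X \<Longrightarrow> v \<in> lists X \<Longrightarrow> child (g u) (g v) \<longleftrightarrow> child u v"
      by (auto simp: tree_automorphisms_def)
    have gm: "g u \<in> lists X" if "u \<in> lists X" for u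
      using Bij_imp_funcset[OF gB] that by (rule funcset_mem)
    have "compose (lists X) f g \<in> Bij (lists X)" using fB gB by (rule compose_Bij)
    moreover have "compose (lists X) f g [] = []" by (simp add: compose_def f0)
    moreover have "child (compose (lists X) f g u) (compose (lists X) f g v) \<longleftrightarrow> child u v"
      if "u \<in> lists X" "v \<in> lists X" for u v
      using fc[OF gm[OF that(1)] gm[OF that(2)]] gc[OF that] that by (simp add: compose_def)
    ultimately show "f \<otimes>\<^bsub>BijGroup (lists X)\<^esub> g \<in> tree_automorphisms X"
      unfolding tree_automorphisms_def using fB gB by (simp add: BijGroup_def)
  qed
qed

lemma group_tree_aut_group: "group (tree_aut_group X)"
  unfolding tree_aut_group_def
  by (rule subgroup.subgroup_is_group[OF subgroup_tree_automorphisms group_BijGroup])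

lemma group_automaton_group: "group (automaton_group A)"
  unfolding automaton_group_def by (rule group.group_subgroup_generated[OF group_tree_aut_group])

lemma length_act: "length (act A q w) = length w"
  by (induction w arbitrary: q) auto

lemma act_append: "\<exists>r. act A q (u @ v) = act A q u @ act A r v"
proof (induction u arbitrary: q)
  case (Cons x u)
  then show ?case by simp
qed auto

lemma act_bij:
  assumes "invertible_automaton A" "q \<in> states A"
  shows "bij_betw (act A q) (lists (alphabet A)) (lists (alphabet A))"
proof -
  let ?X = "alphabet A"
  have tr: "transition_fun A q x \<in> states A" if "q \<in> states A" "x \<in> ?X" for q x
    using assms(1) that by (auto simp: invertible_automaton_def)
  have ob: "bij_betw (output_fun A q) ?X ?X" if "q \<in> states A" for q
    using assms(1) that by (auto simp: invertible_automaton_def)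
  have mem: "act A q u \<in> lists ?X" if "u \<in> lists ?X" "q \<in> states A" for u q
    using that by (induction u arbitrary: q rule: list.induct) (simp_all add: tr bij_betw_apply[OF ob])
  have inj: "u = v" if "u \<in> lists ?X" "v \<in> lists ?X" "q \<in> states A" "act A q u = act A q v" for u v q
    using that
  proof (induction u arbitrary: v q rule: list.induct)
    case Nil
    then show ?case by (cases v) auto
  next
    case (Cons x u)
    then obtain y v' where v: "v = y # v'" by (cases v) auto
    from Cons.prems v have "x \<in> ?X" "y \<in> ?X" "output_fun A q x = output_fun A q y" by simp_all
    then have "x = y"
      using bij_betw_imp_inj_on[OF ob[OF \<open>q \<in> states A\<close>]] by (simp add: inj_on_eq_iff)
    moreover have "u = v'"
      using Cons.prems v \<open>x = y\<close> by (intro Cons.IH[of v' "transition_fun A q x"]) (simp_all add: tr)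
    ultimately show ?case using v by simp
  qed
  have surj: "\<exists>u\<in>lists ?X. act A q u = v" if "v \<in> lists ?X" "q \<in> states A" for v q
    using that
  proof (induction v arbitrary: q rule: list.induct)
    case Nil
    then show ?case by (intro bexI[of _ "[]"]) auto
  next
    case (Cons y v)
    then obtain x where x: "x \<in> ?X" "output_fun A q x = y"
      using bij_betw_imp_surj_on[OF ob[of q]] by (metis Cons_in_lists_iff imageE)
    have "v \<in> lists ?X" "transition_fun A q x \<in> states A" using Cons.prems x tr by simp_all
    from Cons.IH[OF this] obtain u where "u \<in> lists ?X" "act A (transition_fun A q x) u = v" by blast
    with x show ?case by (intro bexI[of _ "x # u"]) simp_all
  qed
  show ?thesis
  proof (rule bij_betw_imageI)
    show "inj_on (act A q) (lists ?X)" using inj assms(2) by (simp add: inj_on_def)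
    show "act A q ` lists ?X = lists ?X"
    proof
      show "act A q ` lists ?X \<subseteq> lists ?X" by (rule image_subsetI) (rule mem[OF _ assms(2)])
      show "lists ?X \<subseteq> act A q ` lists ?X" using surj assms(2) by (metis image_eqI subsetI)
    qed
  qed
qed

lemma state_aut_closed:
  assumes "invertible_automaton A" "q \<in> states A"
  shows "state_aut A q \<in> carrier (tree_aut_group (alphabet A))"
proof -
  let ?X = "alphabet A"
  note bij = act_bij[OF assms]
  have "state_aut A q \<in> Bij (lists ?X)"
    using bij by (simp add: Bij_def state_aut_def cong: bij_betw_cong)
  moreover have "child (act A q u) (act A q v) \<longleftrightarrow> child u v"
    if "u \<in> lists ?X" "v \<in> lists ?X" for u v
  proof
    assume "child u v"
    then obtain x where v: "v = u @ [x]" by (auto simp: child_def)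
    obtain r where "act A q (u @ [x]) = act A q u @ act A r [x]"
      using act_append[of A q u "[x]"] by blast
    then show "child (act A q u) (act A q v)" by (simp add: v child_def)
  next
    assume "child (act A q u) (act A q v)"
    then obtain y where y: "act A q v = act A q u @ [y]" by (auto simp: child_def)
    then have "length v = Suc (length u)" by (metis length_act length_append_singleton)
    then obtain v' x where v: "v = v' @ [x]" by (metis append_butlast_last_id list.size(3) nat.distinct(1))
    obtain r where "act A q (v' @ [x]) = act A q v' @ act A r [x]"
      using act_append[of A q v' "[x]"] by blast
    with y v have "act A q v' = act A q u" by simp
    moreover have "v' \<in> lists ?X" using that v by auto
    ultimately have "v' = u" using bij_betw_imp_inj_on[OF bij] that by (auto dest: inj_onD)
    then show "child u v" by (simp add: v child_def)
  qed
  ultimately show ?thesis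
    by (simp add: tree_aut_group_def tree_automorphisms_def state_aut_def)
qed

lemma carrier_automaton_group:
  assumes "invertible_automaton A"
  shows "carrier (automaton_group A) =
    generate (tree_aut_group (alphabet A)) (state_aut A ` states A)"
proof -
  have "state_aut A ` states A \<subseteq> carrier (tree_aut_group (alphabet A))"
    using state_aut_closed[OF assms] by blast
  then show ?thesis by (simp add: automaton_group_def carrier_subgroup_generated Int_absorb1)
qed

lemma equiv_iso_rel:
  assumes "\<And>G. G \<in> S \<Longrightarrow> group G"
  shows "equiv S (iso_rel S)"
proof (rule equivI)
  show "iso_rel S \<subseteq> S \<times> S" by (auto simp: iso_rel_def)
  show "refl_on S (iso_rel S)" by (auto simp: iso_rel_def refl_on_def)
  show "sym (iso_rel S)" using assms by (auto simp: iso_rel_def sym_def intro: group.iso_sym)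
  show "trans (iso_rel S)" unfolding iso_rel_def trans_def using iso_trans by blast
qed

end

theory Submission
  imports Defs
begin

text \<open>
  An automaton with three states over two letters is, up to renaming, one of 18^3 = 5832
  codes: lists of three entries (l, r, s), where l and r are the states reached by reading the
  first and the second letter, and s tells whether the state exchanges the two letters
  (automaton_group_code). The bound 124 is reached in two stages.

  The first stage uses only the evident symmetries. Renaming the states, exchanging the letters
  and replacing every state by its inverse do not change the isomorphism type of the group, and
  neither does identifying states that act alike. All of these are instances of one statement
  about maps between automata (simulation_iso, morphism_iso). A code that becomes smaller under
  one of these operations can be discarded, and an exhaustive check over the codes that survive
  a few symmetries applied by hand (irreducible_three_states) shows that 195 codes with at most
  three states remain.

  The second stage merges 71 of the 195 codes into others. In each case there is an automorphism
  d of the binary tree that conjugates one group onto the other; often d is trivial and the two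
  groups coincide, and otherwise d is built from symbols given by a wreath recursion such as
  d = (d, a d b), whose sections are words in such symbols and in the states of the two automata. That d conjugates the
  generators of one group to given words of the other group and conversely is a finite set of
  relations between words. A relation is proved by self-similarity: if every word of a finite set
  R fixes the first level, and its two sections can be turned into the empty word by
  inserting conjugates of elements of R and cancelling, then all words of R act trivially on each
  level, by induction on the level (closed_relators_trivial). A certificate consists of d, the
  words, the set R and the insertions (certificate_iso). The certificates connect the merged
  codes to the remaining 195 - 71 = 124 (representatives_cover), and an isomorphism class of
  automaton groups is determined by a representative isomorphic to its members.

  A conjugator can be read off recursively. If d fixes the first level and carries an active u with
  sections u0, u1 to v with sections v0, v1, then the sections of d satisfy d1 = u0\<inverse> d0 v0, and d0
  has to carry the generators of the stabilizer of the first letter, restricted to the subtree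
  below it, to the corresponding generators for the other group. The recursion closes as soon as
  this is a problem that has occurred before.
\<close>

section \<open>Words over a wreath recursion\<close>

type_synonym word = "int list"
type_synonym recursion = "(word \<times> word \<times> bool) list"

text \<open>
  A wreath recursion lists for the symbols 1, 2, ... the words that describe the sections at the
  letters False and True, and whether the symbol exchanges the letters. A word is a list of
  symbols, negated for inverses. Integers outside the range of the list stand for the identity, so
  that every integer is a symbol.
\<close>
fun entry :: "recursion \<Rightarrow> int \<Rightarrow> word \<times> word \<times> bool" where
  "entry [] i = ([], [], False)"
| "entry (e # T) i = (if i = 1 then e else entry T (i - 1))"

fun winv :: "word \<Rightarrow> word" where
  "winv [] = []"
| "winv (l # w) = winv w @ [- l]"

definition active :: "recursion \<Rightarrow> int \<Rightarrow> bool" where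
  "active T l = snd (snd (entry T \<bar>l\<bar>))"

definition side :: "word \<times> word \<times> bool \<Rightarrow> bool \<Rightarrow> word" where
  "side e x = (if x then fst (snd e) else fst e)"

definition lsec :: "recursion \<Rightarrow> int \<Rightarrow> bool \<Rightarrow> word" where
  "lsec T l x = (if 0 \<le> l then side (entry T \<bar>l\<bar>) x
     else winv (side (entry T \<bar>l\<bar>) (x \<noteq> active T l)))"

primrec wactive :: "recursion \<Rightarrow> word \<Rightarrow> bool" where
  "wactive T [] = False"
| "wactive T (l # w) = (active T l \<noteq> wactive T w)"

primrec wsec :: "recursion \<Rightarrow> word \<Rightarrow> bool \<Rightarrow> word" where
  "wsec T [] x = []"
| "wsec T (l # w) x = lsec T l x @ wsec T w (x \<noteq> active T l)"

text \<open>
  A word acts as a state of the infinite automaton whose states are all words. Words are read from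
  left to right: the leftmost letter acts first.
\<close>
primrec wact :: "recursion \<Rightarrow> word \<Rightarrow> bool list \<Rightarrow> bool list" where
  "wact T w [] = []"
| "wact T w (x # v) = (x \<noteq> wactive T w) # wact T (wsec T w x) v"

lemma wactive_append: "wactive T (u @ v) = (wactive T u \<noteq> wactive T v)"
  by (induction u) auto

lemma wsec_append: "wsec T (u @ v) x = wsec T u x @ wsec T v (x \<noteq> wactive T u)"
proof (induction u arbitrary: x)
  case (Cons l u)
  have "((x \<noteq> active T l) \<noteq> wactive T u) = (x \<noteq> (active T l \<noteq> wactive T u))" by blast
  then show ?case using Cons.IH[of "x \<noteq> active T l"] by simp
qed simp

lemma wact_append: "wact T (u @ v) x = wact T v (wact T u x)"
proof (induction x arbitrary: u v)
  case (Cons y x)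
  then show ?case by (auto simp: wactive_append wsec_append)
qed simp

lemma wact_empty [simp]: "wact T [] x = x"
  by (induction x) auto

lemma length_wact [simp]: "length (wact T w x) = length x"
  by (induction x arbitrary: w) auto

lemma winv_append: "winv (u @ v) = winv v @ winv u"
  by (induction u) auto

lemma winv_winv [simp]: "winv (winv w) = w"
  by (induction w) (auto simp: winv_append)

lemma set_winv: "set (winv w) = uminus ` set w"
  by (induction w) auto

lemma active_uminus [simp]: "active T (- l) = active T l"
  by (simp add: active_def)

lemma wactive_winv [simp]: "wactive T (winv w) = wactive T w"
  by (induction w) (auto simp: wactive_append)

lemma entry_nonpos: "i \<le> 0 \<Longrightarrow> entry T i = ([], [], False)"
  by (induction T arbitrary: i) auto

text \<open>
  The section of an inverse at the image of a letter inverts the section at that letter.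
\<close>
lemma lsec_uminus: "lsec T (- l) (x \<noteq> active T l) = winv (lsec T l x)"
proof (cases l "0 :: int" rule: linorder_cases)
  case equal
  then show ?thesis by (simp add: lsec_def side_def active_def entry_nonpos)
next
  case greater
  have "((x \<noteq> active T l) \<noteq> active T l) = x" by blast
  then show ?thesis using greater by (simp add: lsec_def del: not_iff)
qed (auto simp: lsec_def active_def)

lemma wsec_winv: "wsec T (winv w) (x \<noteq> wactive T w) = winv (wsec T w x)"
proof (induction w arbitrary: x)
  case (Cons l w)
  have 1: "(x \<noteq> (active T l \<noteq> wactive T w)) = ((x \<noteq> active T l) \<noteq> wactive T w)" by blast
  have 2: "((x \<noteq> (active T l \<noteq> wactive T w)) \<noteq> wactive T w) = (x \<noteq> active T l)" by blast
  have "wsec T (winv (l # w)) (x \<noteq> wactive T (l # w)) =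
    wsec T (winv w) (x \<noteq> (active T l \<noteq> wactive T w)) @ lsec T (- l) (x \<noteq> active T l)"
    by (simp only: winv.simps wsec_append wactive.simps wactive_winv wsec.simps append_Nil2 2)
  also have "\<dots> = winv (wsec T w (x \<noteq> active T l)) @ winv (lsec T l x)"
    unfolding 1 Cons.IH lsec_uminus ..
  finally show ?case by (simp add: winv_append)
qed simp

lemma wact_winv [simp]: "wact T (winv w) (wact T w x) = x"
proof (induction x arbitrary: w)
  case (Cons y x)
  then show ?case using wsec_winv[of T w y] by auto
qed simp

lemma wact_winv' [simp]: "wact T w (wact T (winv w) x) = x"
  using wact_winv[of T "winv w" x] by simp

section \<open>Groups generated by symbols, and isomorphisms between them\<close>

definition words :: "int set \<Rightarrow> word set" where
  "words I = {w. set w \<subseteq> I \<union> uminus ` I}"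

definition wgroup :: "recursion \<Rightarrow> int set \<Rightarrow> (bool list \<Rightarrow> bool list) monoid" where
  "wgroup T I = \<lparr>carrier = wact T ` words I, mult = (\<circ>), one = id\<rparr>"

lemma words_append: "u \<in> words I \<Longrightarrow> v \<in> words I \<Longrightarrow> u @ v \<in> words I"
  by (auto simp: words_def)

lemma words_winv: "w \<in> words I \<Longrightarrow> winv w \<in> words I"
  by (force simp: words_def set_winv)

lemma words_Nil [simp]: "[] \<in> words I"
  by (simp add: words_def)

lemma words_Cons: "l # w \<in> words I \<longleftrightarrow> (l \<in> I \<or> - l \<in> I) \<and> w \<in> words I"
  by (force simp: words_def)

lemma group_wgroup: "group (wgroup T I)"
proof (rule groupI)
  fix f assume "f \<in> carrier (wgroup T I)"
  then obtain w where w: "w \<in> words I" "f = wact T w" by (auto simp: wgroup_def)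
  show "\<exists>g\<in>carrier (wgroup T I). g \<otimes>\<^bsub>wgroup T I\<^esub> f = \<one>\<^bsub>wgroup T I\<^esub>"
  proof
    show "wact T (winv w) \<otimes>\<^bsub>wgroup T I\<^esub> f = \<one>\<^bsub>wgroup T I\<^esub>"
      by (simp add: wgroup_def w fun_eq_iff)
    show "wact T (winv w) \<in> carrier (wgroup T I)"
      using w words_winv by (auto simp: wgroup_def)
  qed
next
  fix f g assume "f \<in> carrier (wgroup T I)" "g \<in> carrier (wgroup T I)"
  then obtain u v where "u \<in> words I" "f = wact T u" "v \<in> words I" "g = wact T v"
    by (auto simp: wgroup_def)
  then have "f \<circ> g = wact T (v @ u)" "v @ u \<in> words I"
    by (auto simp: wact_append words_append)
  then show "f \<otimes>\<^bsub>wgroup T I\<^esub> g \<in> carrier (wgroup T I)" by (auto simp: wgroup_def)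
next
  have "id = wact T []" by (simp add: fun_eq_iff)
  then show "\<one>\<^bsub>wgroup T I\<^esub> \<in> carrier (wgroup T I)"
    by (auto simp: wgroup_def intro: image_eqI[of _ _ "[]"])
qed (auto simp: wgroup_def o_assoc)

text \<open>
  Conjugation by a bijection \<phi> of the words over the two letters is an isomorphism as soon as it
  carries the generators of each group into the other one. For the identity this says that two
  sets of generators generate the same group.
\<close>
lemma conjugation_iso:
  assumes inv: "\<And>x. \<psi> (\<phi> x) = x" "\<And>x. \<phi> (\<psi> x) = x"
    and fwd: "\<And>i. i \<in> I \<Longrightarrow> \<exists>w\<in>words J. \<forall>x. \<phi> (wact T [i] x) = wact T' w (\<phi> x)"
    and bwd: "\<And>j. j \<in> J \<Longrightarrow> \<exists>w\<in>words I. \<forall>x. \<phi> (wact T w x) = wact T' [j] (\<phi> x)"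
  shows "wgroup T I \<cong> wgroup T' J"
proof -
  let ?c = "\<lambda>f. \<phi> \<circ> f \<circ> \<psi>"
  have inverse: "\<phi> (wact T (winv u) x) = wact T' (winv w) (\<phi> x)"
    if "\<forall>x. \<phi> (wact T u x) = wact T' w (\<phi> x)" for u w x
    using that by (metis wact_winv wact_winv')
  have fwd': "\<exists>w\<in>words J. \<forall>x. \<phi> (wact T u x) = wact T' w (\<phi> x)" if "u \<in> words I" for u
    using that
  proof (induction u)
    case (Cons l u)
    have "\<exists>w\<in>words J. \<forall>x. \<phi> (wact T [l] x) = wact T' w (\<phi> x)"
    proof (cases "l \<in> I")
      case False
      with Cons.prems have "- l \<in> I" by (simp add: words_Cons)
      then obtain w where w: "w \<in> words J" "\<forall>x. \<phi> (wact T [- l] x) = wact T' w (\<phi> x)"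
        using fwd by blast
      then show ?thesis using inverse[of "[- l]" w] words_winv[of w J] by auto
    qed (use fwd in blast)
    then obtain w where w: "w \<in> words J" "\<forall>x. \<phi> (wact T [l] x) = wact T' w (\<phi> x)" by blast
    obtain v where v: "v \<in> words J" "\<forall>x. \<phi> (wact T u x) = wact T' v (\<phi> x)"
      using Cons by (auto simp: words_Cons)
    have "\<phi> (wact T (l # u) x) = wact T' (w @ v) (\<phi> x)" for x
      using wact_append[of T "[l]" u x] w v by (simp add: wact_append)
    then show ?case using w v words_append by blast
  qed (auto intro!: bexI[of _ "[]"])
  have bwd': "\<exists>u\<in>words I. \<forall>x. \<phi> (wact T u x) = wact T' w (\<phi> x)" if "w \<in> words J" for w
    using that
  proof (induction w)
    case (Cons l w)
    have "\<exists>u\<in>words I. \<forall>x. \<phi> (wact T u x) = wact T' [l] (\<phi> x)"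
    proof (cases "l \<in> J")
      case False
      with Cons.prems have "- l \<in> J" by (simp add: words_Cons)
      then obtain u where u: "u \<in> words I" "\<forall>x. \<phi> (wact T u x) = wact T' [- l] (\<phi> x)"
        using bwd by blast
      then show ?thesis using inverse[of u "[- l]"] words_winv[of u I] by auto
    qed (use bwd in blast)
    then obtain u where u: "u \<in> words I" "\<forall>x. \<phi> (wact T u x) = wact T' [l] (\<phi> x)" by blast
    obtain v where v: "v \<in> words I" "\<forall>x. \<phi> (wact T v x) = wact T' w (\<phi> x)"
      using Cons by (auto simp: words_Cons)
    have "\<phi> (wact T (u @ v) x) = wact T' (l # w) (\<phi> x)" for x
      using wact_append[of T' "[l]" w "\<phi> x"] u v by (simp add: wact_append)
    then show ?case using u v words_append by blast
  qed (auto intro!: bexI[of _ "[]"])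
  have conj: "?c (wact T u) = wact T' w" if "\<forall>x. \<phi> (wact T u x) = wact T' w (\<phi> x)" for u w
    using that inv by (simp add: fun_eq_iff)
  have "?c \<in> hom (wgroup T I) (wgroup T' J)"
  proof (rule homI)
    fix f assume "f \<in> carrier (wgroup T I)"
    then obtain u where "u \<in> words I" "f = wact T u" by (auto simp: wgroup_def)
    moreover from this obtain w where "w \<in> words J" "\<forall>x. \<phi> (wact T u x) = wact T' w (\<phi> x)"
      using fwd' by blast
    ultimately show "?c f \<in> carrier (wgroup T' J)" using conj by (auto simp: wgroup_def)
  qed (simp add: wgroup_def fun_eq_iff inv)
  moreover have "inj_on ?c (carrier (wgroup T I))"
  proof (rule inj_onI)
    fix f g assume "?c f = ?c g"
    then have "\<psi> (?c f (\<phi> x)) = \<psi> (?c g (\<phi> x))" for x by simp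
    then show "f = g" by (simp add: inv fun_eq_iff)
  qed
  moreover have "carrier (wgroup T' J) \<subseteq> ?c ` carrier (wgroup T I)"
  proof
    fix g assume "g \<in> carrier (wgroup T' J)"
    then obtain w where "w \<in> words J" "g = wact T' w" by (auto simp: wgroup_def)
    moreover from this obtain u where "u \<in> words I" "\<forall>x. \<phi> (wact T u x) = wact T' w (\<phi> x)"
      using bwd' by blast
    ultimately have "g = ?c (wact T u)" "wact T u \<in> carrier (wgroup T I)"
      using conj[of u w] by (auto simp: wgroup_def)
    then show "g \<in> ?c ` carrier (wgroup T I)" by (rule image_eqI)
  qed
  ultimately have "?c \<in> iso (wgroup T I) (wgroup T' J)"
    by (auto simp: iso_def bij_betw_def hom_def)
  then show ?thesis by (auto simp: is_iso_def)
qed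

text \<open>
  Bisimulation up to inversion of the generators (F may take negative values) and up to a global
  exchange of the two letters (b). Since F only has to map the generators onto the generators of
  the target, it also covers the identification of states.
\<close>
lemma simulation_iso:
  assumes pos: "\<And>i. i \<in> I \<Longrightarrow> 0 < i" "\<And>j. j \<in> J \<Longrightarrow> 0 < j"
    and range: "\<And>i. i \<in> I \<Longrightarrow> F i \<in> J \<or> - F i \<in> J"
    and onto: "\<And>j. j \<in> J \<Longrightarrow> \<exists>i\<in>I. F i = j \<or> F i = - j"
    and act: "\<And>i. i \<in> I \<Longrightarrow> active T' (F i) = active T i"
    and sec: "\<And>i x. i \<in> I \<Longrightarrow> \<exists>j\<in>I. lsec T i x = [j] \<and> lsec T' (F i) (x \<noteq> b) = [F j]"
  shows "wgroup T I \<cong> wgroup T' J"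
proof -
  let ?\<phi> = "map (\<lambda>x. x \<noteq> b)"
  have step: "?\<phi> (wact T [i] x) = wact T' [F i] (?\<phi> x)" if "i \<in> I" for i x
    using that
  proof (induction x arbitrary: i)
    case (Cons y x)
    obtain j where j: "j \<in> I" "lsec T i y = [j]" "lsec T' (F i) (y \<noteq> b) = [F j]"
      using sec[OF Cons.prems] by blast
    show ?case using j Cons.IH[of j] act[OF Cons.prems] by auto
  qed simp
  show ?thesis
  proof (rule conjugation_iso[where \<phi> = ?\<phi> and \<psi> = ?\<phi>])
    fix x :: "bool list"
    show inv: "?\<phi> (?\<phi> x) = x" by (induction x) auto
    then show "?\<phi> (?\<phi> x) = x" .
  next
    fix i assume "i \<in> I"
    then show "\<exists>w\<in>words J. \<forall>x. ?\<phi> (wact T [i] x) = wact T' w (?\<phi> x)"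
      using range step by (intro bexI[of _ "[F i]"]) (auto simp: words_Cons)
  next
    fix j assume "j \<in> J"
    then obtain i where i: "i \<in> I" "F i = j \<or> F i = - j" using onto by blast
    show "\<exists>w\<in>words I. \<forall>x. ?\<phi> (wact T w x) = wact T' [j] (?\<phi> x)"
    proof (cases "F i = j")
      case True
      then show ?thesis using i step by (intro bexI[of _ "[i]"]) (auto simp: words_Cons)
    next
      case False
      then have F: "F i = - j" using i by blast
      have "?\<phi> (wact T [- i] x) = wact T' [j] (?\<phi> x)" for x
      proof -
        have "?\<phi> x = wact T' [- j] (?\<phi> (wact T [- i] x))"
          using step[OF i(1), of "wact T [- i] x"] F wact_winv'[of T "[i]" x] by simp
        then show ?thesis using wact_winv'[of T' "[j]"] by simp
      qed
      then show ?thesis using i by (intro bexI[of _ "[- i]"]) (auto simp: words_Cons)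
    qed
  qed
qed

section \<open>Relations from finite self-similar sets of relators\<close>

fun push :: "int \<Rightarrow> word \<Rightarrow> word" where
  "push l [] = [l]"
| "push l (m # w) = (if l + m = 0 then w else l # m # w)"

fun freduce :: "word \<Rightarrow> word" where
  "freduce [] = []"
| "freduce (l # w) = push l (freduce w)"

lemma wact_Cons: "wact T (l # w) x = wact T w (wact T [l] x)"
  using wact_append[of T "[l]" w x] by simp

lemma wact_push: "wact T (push l w) x = wact T (l # w) x"
proof (cases w)
  case (Cons m v)
  then show ?thesis
    using wact_winv[of T "[l]" x]
    by (auto simp: wact_Cons[of T _ "_ # _"] wact_Cons[of T _ v] add_eq_0_iff simp del: wact_winv)
qed simp

lemma wact_freduce: "wact T (freduce w) x = wact T w x"
proof (induction w arbitrary: x)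
  case (Cons l w)
  have "wact T (freduce (l # w)) x = wact T (freduce w) (wact T [l] x)"
    by (simp only: freduce.simps wact_push wact_Cons[of T l "freduce w"])
  then show ?case by (simp only: Cons.IH wact_Cons[of T l w])
qed simp

text \<open>
  The positions in lists of the next three functions are integers rather than natural numbers:
  these functions are evaluated by the simplifier, which is faster on binary numerals.
\<close>
fun insert_at :: "int \<Rightarrow> word \<Rightarrow> word \<Rightarrow> word" where
  "insert_at p c [] = c"
| "insert_at p c (l # w) = (if p = 0 then c @ l # w else l # insert_at (p - 1) c w)"

fun rot :: "int \<Rightarrow> word \<Rightarrow> word \<Rightarrow> word" where
  "rot j acc [] = rev acc"
| "rot j acc (l # w) = (if j = 0 then l # w @ rev acc else rot (j - 1) (l # acc) w)"

text \<open>
  Relators are numbered from 1, and a negative number selects the inverse of a relator.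
\<close>
fun pick :: "word list \<Rightarrow> int \<Rightarrow> word" where
  "pick [] k = []"
| "pick (r # R) k = (if k = 1 then r else if k = - 1 then winv r
     else pick R (if 0 < k then k - 1 else k + 1))"

type_synonym trace = "(int \<times> int \<times> int) list"

text \<open>
  A triple (p, k, j) inserts at position p the k-th relator, rotated by j letters, and cancels. Such
  a trace is a proof that the word is a product of conjugates of relators.
\<close>
fun closes :: "word list \<Rightarrow> word \<Rightarrow> trace \<Rightarrow> bool" where
  "closes R w [] = (w = [])"
| "closes R w ((p, k, j) # t) = closes R (freduce (insert_at p (rot j [] (pick R k)) w)) t"

definition trivial_upto :: "recursion \<Rightarrow> nat \<Rightarrow> word \<Rightarrow> bool" where
  "trivial_upto T n w \<longleftrightarrow> (\<forall>x. length x \<le> n \<longrightarrow> wact T w x = x)"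

lemma trivial_upto_insert:
  "trivial_upto T n c \<Longrightarrow> trivial_upto T n (u @ c @ v) \<longleftrightarrow> trivial_upto T n (u @ v)"
  by (simp add: trivial_upto_def wact_append)

lemma trivial_upto_winv: "trivial_upto T n c \<Longrightarrow> trivial_upto T n (winv c)"
  unfolding trivial_upto_def by (metis wact_winv)

lemma trivial_upto_swap: "trivial_upto T n (u @ v) \<Longrightarrow> trivial_upto T n (v @ u)"
  unfolding trivial_upto_def wact_append by (metis length_wact wact_winv)

lemma insert_at_split: "\<exists>u v. w = u @ v \<and> insert_at p c w = u @ c @ v"
proof (induction w arbitrary: p)
  case (Cons l w)
  obtain u v where uv: "w = u @ v" "insert_at (p - 1) c w = u @ c @ v" using Cons by blast
  show ?case
  proof (cases "p = 0")
    case False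
    then show ?thesis using uv by (intro exI[of _ "l # u"] exI[of _ v]) simp
  next
    case True
    then show ?thesis by (intro exI[of _ "[]"] exI[of _ "l # w"]) simp
  qed
qed simp

lemma trivial_upto_rot: "trivial_upto T n (rev acc @ w) \<Longrightarrow> trivial_upto T n (rot j acc w)"
proof (induction w arbitrary: j acc)
  case (Cons l w)
  then show ?case using Cons.IH[of "l # acc"] trivial_upto_swap[of T n "rev acc" "l # w"] by auto
qed simp

lemma trivial_upto_pick: "\<forall>r\<in>set R. trivial_upto T n r \<Longrightarrow> trivial_upto T n (pick R k)"
  by (induction R arbitrary: k) (auto simp: trivial_upto_winv, simp add: trivial_upto_def)

lemma trivial_upto_closes:
  assumes "\<forall>r\<in>set R. trivial_upto T n r"
  shows "closes R w t \<Longrightarrow> trivial_upto T n w"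
proof (induction t arbitrary: w)
  case Nil
  then show ?case by (simp add: trivial_upto_def)
next
  case (Cons s t)
  obtain p k j where s: "s = (p, k, j)" by (cases s)
  let ?c = "rot j [] (pick R k)"
  have c: "trivial_upto T n ?c"
    using trivial_upto_pick[OF assms] by (intro trivial_upto_rot) simp
  have "trivial_upto T n (freduce (insert_at p ?c w))" using Cons s by auto
  then have "trivial_upto T n (insert_at p ?c w)" by (simp add: trivial_upto_def wact_freduce)
  then show ?case using insert_at_split[of w p ?c] trivial_upto_insert[OF c] by metis
qed

text \<open>
  Conditionals replace conjunctions here and in the other checkers because the simplifier
  evaluates the condition first and a branch only when it is selected.
\<close>
fun closed_relators :: "recursion \<Rightarrow> word list \<Rightarrow> (word \<times> trace \<times> trace) list \<Rightarrow> bool" where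
  "closed_relators T R [] = True"
| "closed_relators T R ((r, s, t) # rs) =
     (if wactive T r then False
      else if closes R (freduce (wsec T r False)) s
      then (if closes R (freduce (wsec T r True)) t then closed_relators T R rs else False)
      else False)"

lemma closed_relators_iff:
  "closed_relators T R rs \<longleftrightarrow> (\<forall>(r, s, t)\<in>set rs. \<not> wactive T r \<and>
     closes R (freduce (wsec T r False)) s \<and> closes R (freduce (wsec T r True)) t)"
  by (induction T R rs rule: closed_relators.induct) auto

text \<open>
  The sections of relators are products of conjugates of relators, so triviality on level n
  carries over to level n + 1. That R is used to reduce the sections of its own elements is no
  circle, since passing to sections decreases the level.
\<close>
lemma closed_relators_trivial:
  assumes "closed_relators T (map fst rs) rs" "r \<in> set (map fst rs)"
  shows "trivial_upto T n r"
  using assms(2)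
proof (induction n arbitrary: r)
  case 0
  then show ?case by (simp add: trivial_upto_def)
next
  case (Suc n)
  then have R: "\<forall>r\<in>set (map fst rs). trivial_upto T n r" by blast
  from Suc.prems obtain s t where "(r, s, t) \<in> set rs" by auto
  with assms(1) have r: "\<not> wactive T r" "closes (map fst rs) (freduce (wsec T r False)) s"
      "closes (map fst rs) (freduce (wsec T r True)) t"
    unfolding closed_relators_iff by blast+
  have "trivial_upto T n (wsec T r x)" for x
    using r(2,3)[THEN trivial_upto_closes[OF R]]
    by (cases x) (simp_all add: trivial_upto_def wact_freduce)
  moreover have "wact T r x = x" if "length x \<le> Suc n" "\<And>y. trivial_upto T n (wsec T r y)" for x
    using that r(1) by (cases x) (auto simp: trivial_upto_def)
  ultimately show ?case by (auto simp: trivial_upto_def)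
qed

lemma closes_trivial:
  assumes "closed_relators T (map fst rs) rs" "closes (map fst rs) (freduce w) t"
  shows "wact T w x = x"
proof -
  have "trivial_upto T (length x) (freduce w)"
    using trivial_upto_closes[OF _ assms(2)] closed_relators_trivial[OF assms(1)] by blast
  then show ?thesis by (simp add: trivial_upto_def wact_freduce)
qed

section \<open>Codes of automata and conjugacy certificates\<close>

type_synonym code = "(int \<times> int \<times> bool) list"

text \<open>
  Every section of a state is a single state. The shift k makes room for the symbols of another
  automaton in the same wreath recursion.
\<close>
fun table :: "int \<Rightarrow> code \<Rightarrow> recursion" where
  "table k [] = []"
| "table k ((l, r, s) # A) = ([l + k], [r + k], s) # table k A"

definition code_group :: "code \<Rightarrow> (bool list \<Rightarrow> bool list) monoid" where
  "code_group A = wgroup (table 0 A) {1..int (length A)}"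

definition valid_code :: "code \<Rightarrow> bool" where
  "valid_code A \<longleftrightarrow> (\<forall>(l, r, s)\<in>set A. l \<in> {1..int (length A)} \<and> r \<in> {1..int (length A)})"

lemma length_table [simp]: "length (table k A) = length A"
  by (induction k A rule: table.induct) auto

lemma entry_append:
  "entry (S @ T) i = (if i \<le> int (length S) then entry S i else entry T (i - int (length S)))"
proof (induction S arbitrary: i)
  case Nil
  then show ?case by (simp add: entry_nonpos)
qed (auto simp: algebra_simps)

lemma entry_table:
  assumes "1 \<le> i" "i \<le> int (length A)"
  obtains l r s where "(l, r, s) \<in> set A" "A ! nat (i - 1) = (l, r, s)"
    "\<And>k. entry (table k A) i = ([l + k], [r + k], s)"
  using assms
proof (induction A arbitrary: i thesis)
  case (Cons e A)
  obtain l r s where e: "e = (l, r, s)" by (cases e)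
  show ?case
  proof (cases "i = 1")
    case True
    then show ?thesis using Cons.prems(1)[of l r s] e by simp
  next
    case False
    with Cons.prems have "1 \<le> i - 1" "i - 1 \<le> int (length A)" by auto
    then obtain l r s where 1: "(l, r, s) \<in> set A" "A ! nat (i - 1 - 1) = (l, r, s)"
      "\<And>k. entry (table k A) (i - 1) = ([l + k], [r + k], s)"
      using Cons.IH by blast
    have "nat (i - 1) = Suc (nat (i - 1 - 1))" using \<open>1 \<le> i - 1\<close> by simp
    then show ?thesis using Cons.prems(1)[of l r s] 1 e False by simp
  qed
qed simp

lemma embedded_code_group:
  assumes A: "valid_code A"
    and T: "T = S @ table (int (length S)) A @ S'"
  shows "code_group A \<cong> wgroup T {int (length S) + 1..int (length S) + int (length A)}"
  unfolding code_group_def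
proof (rule simulation_iso[where F = "\<lambda>i. i + int (length S)" and b = False])
  fix i assume "i \<in> {1..int (length A)}"
  then have i: "1 \<le> i" "i \<le> int (length A)" by auto
  obtain l r s where e: "(l, r, s) \<in> set A"
      "\<And>k. entry (table k A) i = ([l + k], [r + k], s)"
    using entry_table[OF i] by metis
  have T': "entry T (i + int (length S)) = ([l + int (length S)], [r + int (length S)], s)"
    using i e by (simp add: T entry_append)
  show "active T (i + int (length S)) = active (table 0 A) i"
    using i e T' by (simp add: active_def)
  show "\<exists>j\<in>{1..int (length A)}. lsec (table 0 A) i x = [j] \<and>
      lsec T (i + int (length S)) (x \<noteq> False) = [j + int (length S)]" for x
    using i e(1) A T' e(2)[of 0]
    by (intro bexI[of _ "if x then r else l"]) (auto simp: lsec_def side_def valid_code_def)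
next
  fix j assume "j \<in> {int (length S) + 1..int (length S) + int (length A)}"
  then show "\<exists>i\<in>{1..int (length A)}. i + int (length S) = j \<or> i + int (length S) = - j"
    by (intro bexI[of _ "j - int (length S)"]) auto
qed auto

fun letters_in :: "int \<Rightarrow> int \<Rightarrow> word \<Rightarrow> bool" where
  "letters_in a b [] = True"
| "letters_in a b (l # w) = (if a \<le> \<bar>l\<bar> then (if \<bar>l\<bar> \<le> b then letters_in a b w else False) else False)"

lemma letters_in_words: "letters_in a b w \<Longrightarrow> w \<in> words {a..b}"
  by (induction w) (auto simp: words_Cons abs_if split: if_splits)

text \<open>
  The two checkers verify, for the generators i of the first and j of the second group, relations
  i d = d w and v d = d j with words w and v of the respective other group; i and j run through
  consecutive symbols, beginning with the given one.
\<close>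
fun check_forward :: "word list \<Rightarrow> int \<Rightarrow> int \<Rightarrow> word \<Rightarrow> int \<Rightarrow> (word \<times> trace) list \<Rightarrow> bool" where
  "check_forward R a b d i [] = True"
| "check_forward R a b d i ((w, t) # ws) =
     (if letters_in a b w then
       (if closes R (freduce (i # d @ winv w @ winv d)) t then check_forward R a b d (i + 1) ws else False)
      else False)"

fun check_backward :: "word list \<Rightarrow> int \<Rightarrow> int \<Rightarrow> word \<Rightarrow> int \<Rightarrow> (word \<times> trace) list \<Rightarrow> bool" where
  "check_backward R a b d i [] = True"
| "check_backward R a b d i ((w, t) # ws) =
     (if letters_in a b w then
       (if closes R (freduce (w @ d @ - i # winv d)) t then check_backward R a b d (i + 1) ws else False)
      else False)"

lemma check_forwardD:
  assumes "check_forward R a b d i ws" "i \<le> j" "j < i + int (length ws)"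
  shows "\<exists>w\<in>words {a..b}. \<exists>t. closes R (freduce (j # d @ winv w @ winv d)) t"
  using assms
proof (induction R a b d i ws rule: check_forward.induct)
  case (2 R a b d i w t ws)
  then show ?case
    by (cases "i = j") (use letters_in_words in \<open>auto split: if_splits\<close>)
qed simp

lemma check_backwardD:
  assumes "check_backward R a b d i ws" "i \<le> j" "j < i + int (length ws)"
  shows "\<exists>w\<in>words {a..b}. \<exists>t. closes R (freduce (w @ d @ - j # winv d)) t"
  using assms
proof (induction R a b d i ws rule: check_backward.induct)
  case (2 R a b d i w t ws)
  then show ?case
    by (cases "i = j") (use letters_in_words in \<open>auto split: if_splits\<close>)
qed simp

fun valid_entries :: "int \<Rightarrow> code \<Rightarrow> bool" where
  "valid_entries n [] = True"
| "valid_entries n ((l, r, s) # A) =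
    (if 1 \<le> l then if l \<le> n then if 1 \<le> r then if r \<le> n then valid_entries n A
     else False else False else False else False)"

lemma valid_entries_code: "valid_entries (int (length A)) A \<Longrightarrow> valid_code A"
proof -
  have "\<forall>(l, r, s)\<in>set B. l \<in> {1..n} \<and> r \<in> {1..n}" if "valid_entries n B" for n B
    using that by (induction n B rule: valid_entries.induct) (auto split: if_splits)
  then show "valid_entries (int (length A)) A \<Longrightarrow> valid_code A"
    unfolding valid_code_def by blast
qed

fun len :: "'a list \<Rightarrow> int" where
  "len [] = 0"
| "len (x # xs) = len xs + 1"

lemma len_length: "len xs = int (length xs)"
  by (induction xs) auto

text \<open>
  A single wreath recursion contains the states of A, then those of B, then the symbols D from which
  the conjugator d is built. The lists ws and vs express the conjugated states of A by those of B,
  and the other way round; rs contains the relators with traces for their two sections.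
\<close>
definition valid_certificate ::
    "code \<Rightarrow> code \<Rightarrow> recursion \<Rightarrow> word \<Rightarrow> (word \<times> trace) list \<Rightarrow> (word \<times> trace) list \<Rightarrow>
     (word \<times> trace \<times> trace) list \<Rightarrow> bool" where
  "valid_certificate A B D d ws vs rs =
    (if valid_entries (len A) A then if valid_entries (len B) B
     then if len ws = len A then if len vs = len B
     then if closed_relators (table 0 A @ table (len A) B @ D) (map fst rs) rs
     then if check_forward (map fst rs) (len A + 1) (len A + len B) d 1 ws
     then check_backward (map fst rs) 1 (len A) d (len A + 1) vs
     else False else False else False else False else False else False)"

lemma certificate_iso:
  assumes "valid_certificate A B D d ws vs rs"
  shows "code_group A \<cong> code_group B"
proof -
  define a b where "a = int (length A)" and "b = int (length B)"
  define T where "T = table 0 A @ table a B @ D"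
  from assms have valid: "valid_code A" "valid_code B"
    and len: "int (length ws) = a" "int (length vs) = b"
    and R: "closed_relators T (map fst rs) rs"
    and fwd: "check_forward (map fst rs) (a + 1) (a + b) d 1 ws"
    and bwd: "check_backward (map fst rs) 1 a d (a + 1) vs"
    using valid_entries_code
    by (auto simp: valid_certificate_def len_length T_def a_def b_def split: if_splits)
  have equal: "wact T u x = wact T v x" if "\<And>x. wact T (u @ winv v) x = x" for u v x
    using that[of x] by (metis wact_append wact_winv')
  have conj: "wgroup T {1..a} \<cong> wgroup T {a + 1..a + b}"
  proof (rule conjugation_iso[where \<phi> = "wact T d" and \<psi> = "wact T (winv d)"])
    fix i assume "i \<in> {1..a}"
    with check_forwardD[OF fwd, of i] len(1)
    obtain w t where w: "w \<in> words {a + 1..a + b}"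
      "closes (map fst rs) (freduce (i # d @ winv w @ winv d)) t" by auto
    have "wact T ([i] @ d) x = wact T (d @ w) x" for x
      using closes_trivial[OF R w(2)] by (intro equal) (simp add: winv_append)
    then show "\<exists>w\<in>words {a + 1..a + b}. \<forall>x. wact T d (wact T [i] x) = wact T w (wact T d x)"
      using w(1) unfolding wact_append by blast
  next
    fix j assume "j \<in> {a + 1..a + b}"
    with check_backwardD[OF bwd, of j] len(2)
    obtain w t where w: "w \<in> words {1..a}"
      "closes (map fst rs) (freduce (w @ d @ - j # winv d)) t" by auto
    have "wact T (w @ d) x = wact T (d @ [j]) x" for x
      using closes_trivial[OF R w(2)] by (intro equal) (simp add: winv_append)
    then show "\<exists>w\<in>words {1..a}. \<forall>x. wact T d (wact T w x) = wact T [j] (wact T d x)"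
      using w(1) unfolding wact_append by blast
  qed simp_all
  have "code_group A \<cong> wgroup T {1..a}"
    using embedded_code_group[OF valid(1), of T "[]" "table a B @ D"] by (simp add: T_def a_def)
  moreover have "code_group B \<cong> wgroup T {a + 1..a + b}"
    using embedded_code_group[OF valid(2), of T "table 0 A" D] by (simp add: T_def a_def b_def)
  moreover have "group (code_group B)" by (simp add: code_group_def group_wgroup)
  ultimately show ?thesis using conj by (meson group.iso_sym iso_trans)
qed

section \<open>Symmetries and quotients of codes\<close>

fun app :: "int list \<Rightarrow> int \<Rightarrow> int" where
  "app [] i = 0"
| "app (x # xs) i = (if i = 1 then x else app xs (i - 1))"

fun state :: "code \<Rightarrow> int \<Rightarrow> int \<times> int \<times> bool" where
  "state [] i = (0, 0, False)"
| "state (q # A) i = (if i = 1 then q else state A (i - 1))"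

text \<open>
  The entry of a state after renaming the states by f, inverting if e, and exchanging the letters
  if b. Inversion exchanges the sections of an active state only, so that both operations together
  leave the sections of an active state in place.
\<close>
fun transform :: "int list \<Rightarrow> bool \<Rightarrow> bool \<Rightarrow> int \<times> int \<times> bool \<Rightarrow> int \<times> int \<times> bool" where
  "transform f e b (l, r, s) =
     (if (if e then s else False) = b then (app f l, app f r, s) else (app f r, app f l, s))"

text \<open>
  Applied to xs = f, the condition says that renaming by f, with the options e and b, is compatible with
  the transitions of B; f may identify states.
\<close>
fun morphism :: "int list \<Rightarrow> bool \<Rightarrow> bool \<Rightarrow> code \<Rightarrow> int list \<Rightarrow> code \<Rightarrow> bool" where
  "morphism f e b B [] [] = True"
| "morphism f e b B [] (q # A) = False"
| "morphism f e b B (x # xs) [] = False"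
| "morphism f e b B (x # xs) (q # A) =
     (if transform f e b q = state B x then morphism f e b B xs A else False)"

lemma app_nth: "1 \<le> i \<Longrightarrow> i \<le> int (length f) \<Longrightarrow> app f i = f ! nat (i - 1)"
proof (induction f arbitrary: i)
  case (Cons x f)
  have "nat (i - 1) = Suc (nat (i - 1 - 1))" if "i \<noteq> 1" using that Cons.prems by simp
  then show ?case using Cons by auto
qed simp

lemma state_nth: "1 \<le> i \<Longrightarrow> i \<le> int (length f) \<Longrightarrow> state f i = f ! nat (i - 1)"
proof (induction f arbitrary: i)
  case (Cons x f)
  have "nat (i - 1) = Suc (nat (i - 1 - 1))" if "i \<noteq> 1" using that Cons.prems by simp
  then show ?case using Cons by auto
qed simp

lemma morphism_nth:
  "morphism f e b B xs A \<longleftrightarrow>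
     length xs = length A \<and> (\<forall>i<length A. transform f e b (A ! i) = state B (xs ! i))"
proof (induction f e b B xs A rule: morphism.induct)
  case (4 f e b B x xs q A)
  then show ?case by (auto simp: less_Suc_eq_0_disj)
qed auto

lemma entry_state:
  assumes "1 \<le> i" "i \<le> int (length A)" "state A i = (l, r, s)"
  shows "entry (table 0 A) i = ([l], [r], s)"
  using entry_table[OF assms(1,2)] assms by (metis add.right_neutral prod.inject state_nth)

lemma morphism_iso:
  assumes m: "morphism f e b B f A" and f: "set f = {1..int (length B)}" and A: "valid_code A"
  shows "code_group A \<cong> code_group B"
  unfolding code_group_def
proof (rule simulation_iso[where F = "\<lambda>i. if e then - app f i else app f i" and b = b])
  have len: "length f = length A" using m by (simp add: morphism_nth)
  have range: "app f i \<in> {1..int (length B)}" if "i \<in> {1..int (length A)}" for i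
    using that len app_nth[of i f] nth_mem[of "nat (i - 1)" f] f by auto
  fix i assume i: "i \<in> {1..int (length A)}"
  show "(if e then - app f i else app f i) \<in> {1..int (length B)} \<or>
    - (if e then - app f i else app f i) \<in> {1..int (length B)}"
    using range[OF i] by auto
  obtain l r s where lrs: "state A i = (l, r, s)" by (metis prod_cases3)
  then have mem: "l \<in> {1..int (length A)}" "r \<in> {1..int (length A)}"
    using A i nth_mem[of "nat (i - 1)" A] state_nth[of i A] by (fastforce simp: valid_code_def)+
  have tr: "state B (app f i) = transform f e b (l, r, s)"
  proof -
    have "transform f e b (A ! nat (i - 1)) = state B (f ! nat (i - 1))"
    proof -
      have "nat (i - 1) < length A" using i by auto
      then show ?thesis using m by (simp add: morphism_nth)
    qed
    then show ?thesis using i len lrs app_nth[of i f] state_nth[of i A] by simp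
  qed
  have eA: "entry (table 0 A) i = ([l], [r], s)" using entry_state lrs i by simp
  obtain l' r' s' where B: "transform f e b (l, r, s) = (l', r', s')" by (metis prod_cases3)
  have eB: "entry (table 0 B) (app f i) = ([l'], [r'], s')"
    using entry_state[of "app f i" B] tr B range[OF i] by simp
  show "active (table 0 B) (if e then - app f i else app f i) = active (table 0 A) i"
    using eA eB B i range[OF i] by (auto simp: active_def split: if_splits)
  show "\<exists>j\<in>{1..int (length A)}. lsec (table 0 A) i x = [j] \<and>
      lsec (table 0 B) (if e then - app f i else app f i) (x \<noteq> b) =
        [if e then - app f j else app f j]" for x
  proof -
    show ?thesis
      using eA eB B range[OF i] i mem
      by (cases e; cases b; cases s; cases x) (auto simp: lsec_def side_def active_def)
  qed
next
  fix j assume j: "j \<in> {1..int (length B)}"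
  then obtain n where "n < length f" "f ! n = j" using f by (metis in_set_conv_nth)
  moreover have "length f = length A" using m by (simp add: morphism_nth)
  ultimately show "\<exists>i\<in>{1..int (length A)}. (if e then - app f i else app f i) = j \<or>
      (if e then - app f i else app f i) = - j"
    using app_nth[of "int n + 1" f] by (intro bexI[of _ "int n + 1"]) auto
qed auto

fun flags :: "code \<Rightarrow> int list \<Rightarrow> int list" where
  "flags [] acc = acc"
| "flags ((l, r, s) # A) acc = flags A ((if s then 1 else 0) # acc)"

fun sections :: "code \<Rightarrow> int list \<Rightarrow> int list" where
  "sections [] acc = acc"
| "sections ((l, r, s) # A) acc = sections A (r # l # acc)"

text \<open>
  Codes are compared by the number of states, then by the activity of the states, then by the
  sections, in both cases beginning with the last state. The minimal codes of three states have
  the state 1 active and the state 3 inactive.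
\<close>
definition key :: "code \<Rightarrow> int list" where
  "key A = flags A [] @ sections A []"

fun lex_less :: "int list \<Rightarrow> int list \<Rightarrow> bool" where
  "lex_less (x # xs) (y # ys) = (if x = y then lex_less xs ys else x < y)"
| "lex_less _ _ = False"

definition code_less :: "code \<Rightarrow> code \<Rightarrow> bool" where
  "code_less B A = (if len B < len A then True else if len B = len A then lex_less (key B) (key A) else False)"

lemma lex_less_lex:
  assumes "lex_less xs ys" "length xs = length ys" "\<forall>x\<in>set xs. 0 \<le> x" "\<forall>y\<in>set ys. 0 \<le> y"
  shows "(map nat xs, map nat ys) \<in> lex less_than"
  using assms
proof (induction xs ys rule: lex_less.induct)
  case (1 x xs y ys)
  then show ?case by (cases "x = y") simp_all
qed simp_all

lemma length_key: "length (key A) = 3 * length A"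
proof -
  have "length (flags A acc) = length acc + length A" for acc
    by (induction A acc rule: flags.induct) auto
  moreover have "length (sections A acc) = length acc + 2 * length A" for acc
    by (induction A acc rule: sections.induct) auto
  ultimately show ?thesis by (simp add: key_def)
qed

lemma set_flags: "set (flags A acc) \<subseteq> {0, 1} \<union> set acc"
proof (induction A acc rule: flags.induct)
  case (2 l r s A acc)
  then show ?case by (cases s) auto
qed auto

lemma set_sections: "x \<in> set (sections A acc) \<Longrightarrow> x \<in> set acc \<or> (\<exists>(l, r, s)\<in>set A. x = l \<or> x = r)"
proof (induction A acc rule: sections.induct)
  case (2 l r s A acc)
  from 2(2) have "x \<in> set (r # l # acc) \<or> (\<exists>(l, r, s)\<in>set A. x = l \<or> x = r)"
    by (intro 2(1)) simp
  then show ?case by simp blast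
qed simp

lemma key_nonneg:
  assumes "valid_code A"
  shows "\<forall>x\<in>set (key A). 0 \<le> x"
proof
  fix x assume "x \<in> set (key A)"
  then consider "x \<in> set (flags A [])" | "x \<in> set (sections A [])" by (auto simp: key_def)
  then show "0 \<le> x"
  proof cases
    case 1
    then show ?thesis using set_flags[of A "[]"] by auto
  next
    case 2
    then obtain l r s where "(l, r, s) \<in> set A" "x = l \<or> x = r"
      using set_sections[of x A "[]"] by auto
    then show ?thesis using assms unfolding valid_code_def by fastforce
  qed
qed

lemma code_less_lenlex:
  assumes "code_less B A" "valid_code A" "valid_code B"
  shows "(map nat (key B), map nat (key A)) \<in> lenlex less_than"
proof (cases "length B < length A")
  case True
  then show ?thesis by (simp add: lenlex_conv length_key)
next
  case False
  with assms(1) have "length B = length A" "lex_less (key B) (key A)"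
    by (simp_all add: code_less_def len_length split: if_splits)
  then show ?thesis
    using lex_less_lex[of "key B" "key A"] key_nonneg assms(2,3) by (simp add: lenlex_conv length_key)
qed

text \<open>
  The candidate for the image of a code under f takes each entry from some preimage. Whether this is
  independent of the choice is left to morphism.
\<close>
fun first_preimage :: "int list \<Rightarrow> bool \<Rightarrow> bool \<Rightarrow> int list \<Rightarrow> code \<Rightarrow> int \<Rightarrow> int \<times> int \<times> bool" where
  "first_preimage f e b (x # xs) (q # A) j =
     (if x = j then transform f e b q else first_preimage f e b xs A j)"
| "first_preimage f e b _ _ j = (0, 0, False)"

fun image_code :: "int list \<Rightarrow> bool \<Rightarrow> bool \<Rightarrow> code \<Rightarrow> int list \<Rightarrow> code" where
  "image_code f e b A [] = []"
| "image_code f e b A (j # js) = first_preimage f e b f A j # image_code f e b A js"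

definition reduces_by :: "int list \<Rightarrow> bool \<Rightarrow> bool \<Rightarrow> code \<Rightarrow> code \<Rightarrow> bool" where
  "reduces_by f e b A B =
     (if code_less B A then if valid_entries (len B) B then morphism f e b B f A else False else False)"

fun reduces :: "(int list \<times> int list) list \<Rightarrow> code \<Rightarrow> bool" where
  "reduces [] A = False"
| "reduces ((f, js) # fs) A =
    (if reduces_by f False False A (image_code f False False A js) then True
     else if reduces_by f True False A (image_code f True False A js) then True
     else if reduces_by f False True A (image_code f False True A js) then True
     else if reduces_by f True True A (image_code f True True A js) then True
     else reduces fs A)"

lemma length_image_code [simp]: "length (image_code f e b A js) = length js"
  by (induction js) auto

text \<open>
  A reduction is a step to a strictly smaller code of an isomorphic group. The list fs pairs each
  map with the list of states of its image.
\<close>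
lemma reducesD:
  assumes "reduces fs A" "\<forall>(f, js)\<in>set fs. js \<noteq> [] \<and> set f = {1..int (length js)}" "valid_code A"
  shows "\<exists>B. valid_code B \<and> B \<noteq> [] \<and> code_group A \<cong> code_group B \<and>
    length B \<le> length A \<and> (map nat (key B), map nat (key A)) \<in> lenlex less_than"
proof -
  have "\<exists>f js e b. (f, js) \<in> set fs \<and> reduces_by f e b A (image_code f e b A js)"
    using assms(1)
  proof (induction fs)
    case (Cons p fs)
    obtain f js where p: "p = (f, js)" by (cases p)
    show ?case
    proof (cases "reduces fs A")
      case True
      then show ?thesis using Cons.IH by (meson list.set_intros(2))
    next
      case False
      then have "\<exists>e b. reduces_by f e b A (image_code f e b A js)"
        using Cons.prems unfolding p reduces.simps by metis
      then show ?thesis unfolding p by (meson list.set_intros(1))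
    qed
  qed simp
  then obtain f js e b where f: "(f, js) \<in> set fs" "reduces_by f e b A (image_code f e b A js)"
    by blast
  define B where "B = image_code f e b A js"
  have js: "js \<noteq> []" "set f = {1..int (length js)}" using f(1) assms(2) by auto
  then have B: "B \<noteq> []" "set f = {1..int (length B)}"
    unfolding B_def by (metis length_0_conv length_image_code, simp)
  have less: "code_less B A" and valid: "valid_code B" and mor: "morphism f e b B f A"
    using f(2) valid_entries_code by (auto simp: reduces_by_def B_def len_length split: if_splits)
  have "length B \<le> length A" using less by (auto simp: code_less_def len_length split: if_splits)
  then show ?thesis
    using morphism_iso[OF mor B(2) assms(3)] code_less_lenlex[OF less assms(3) valid] valid B(1)
    by blast
qed

fun member :: "code list \<Rightarrow> code \<Rightarrow> bool" where
  "member [] A = False"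
| "member (B # Bs) A = (if A = B then True else member Bs A)"

lemma member_iff: "member Bs A \<longleftrightarrow> A \<in> set Bs"
  by (induction Bs) auto

definition reducible :: "code \<Rightarrow> bool" where
  "reducible A \<longleftrightarrow> (\<exists>B. valid_code B \<and> B \<noteq> [] \<and> code_group A \<cong> code_group B \<and>
     length B \<le> length A \<and> (map nat (key B), map nat (key A)) \<in> lenlex less_than)"

lemma reducibleI:
  assumes "morphism f e b B f A" "set f = {1..int (length B)}" "valid_code A" "valid_code B"
    "B \<noteq> []" "code_less B A"
  shows "reducible A"
proof -
  have "length B \<le> length A"
    using assms(6) by (auto simp: code_less_def len_length split: if_splits)
  then show ?thesis
    unfolding reducible_def using morphism_iso code_less_lenlex assms by blast
qed

text \<open>
  Sorting by hand. Codes whose states are all active or all inactive collapse to one state, and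
  otherwise a permutation of the states puts the active ones first. Inversion together with the
  exchange of letters flips the sections of the inactive states only, and inversion alone those of
  the active ones, which sorts the sections of the state 3 and of the last active state. This cuts
  the exhaustive check from 5832 codes to 648.
\<close>
lemma irreducible_three_states:
  assumes A: "valid_code [(l1, r1, s1), (l2, r2, s2), (l3, r3, s3)]"
    and irr: "\<not> reducible [(l1, r1, s1), (l2, r2, s2), (l3, r3, s3)]"
  shows "s1 \<and> \<not> s3 \<and> r3 \<le> l3 \<and> (if s2 then r2 \<le> l2 else r1 \<le> l1)"
proof -
  let ?A = "[(l1, r1, s1), (l2, r2, s2), (l3, r3, s3)]"
  have mem: "l1 \<in> {1..3}" "r1 \<in> {1..3}" "l2 \<in> {1..3}" "r2 \<in> {1..3}" "l3 \<in> {1..3}" "r3 \<in> {1..3}"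
    using A by (simp_all add: valid_code_def)
  have app: "app [x, y, z] i \<in> {1..3}" if "i \<in> {1..3}" "x \<in> {1..3}" "y \<in> {1..3}" "z \<in> {1..3}" for x y z i
  proof -
    have "i = 1 \<or> i = 2 \<or> i = 3" using that(1) by auto
    then show ?thesis using that by auto
  qed
  have set3: "{1..3 :: int} = {1, 2, 3}" by auto
  \<comment> \<open>Listing the states in the order i, j, k and renaming the sections by the inverse f of this
    permutation gives a code of the same group, which therefore cannot be smaller.\<close>
  have perm: "\<not> code_less (map (transform f e b) [?A ! i, ?A ! j, ?A ! k]) ?A"
    if "f = [x, y, z]" "set f = {1..3}"
      "state [?A ! i, ?A ! j, ?A ! k] x = ?A ! 0" "state [?A ! i, ?A ! j, ?A ! k] y = ?A ! 1"
      "state [?A ! i, ?A ! j, ?A ! k] z = ?A ! 2" "i < 3" "j < 3" "k < 3"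
    for f e b i j k x y z
  proof
    let ?B = "map (transform f e b) [?A ! i, ?A ! j, ?A ! k]"
    assume less: "code_less ?B ?A"
    have xyz: "x \<in> {1..3}" "y \<in> {1..3}" "z \<in> {1..3}" using that(1,2) by auto
    have state: "state ?B u = transform f e b (state [?A ! i, ?A ! j, ?A ! k] u)" if "u \<in> {1..3}" for u
      using that by (auto simp: set3 simp del: transform.simps)
    have "morphism f e b ?B f ?A"
      using that(1,3,4,5) xyz state by (simp del: transform.simps list.map nth_Cons_0 nth_Cons_Suc) simp
    moreover have "valid_code ?B"
    proof -
      have tr: "case transform f e b (l, r, s) of (l', r', s') \<Rightarrow> l' \<in> {1..3} \<and> r' \<in> {1..3}"
        if "l \<in> {1..3}" "r \<in> {1..3}" for l r s
      proof -
        have "app f l \<in> {1..3}" "app f r \<in> {1..3}"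
          unfolding \<open>f = [x, y, z]\<close> using app xyz that by blast+
        then show ?thesis by simp
      qed
      have "case transform f e b (?A ! n) of (l, r, s) \<Rightarrow> l \<in> {1..3} \<and> r \<in> {1..3}" if "n < 3" for n
      proof -
        have "n = 0 \<or> n = 1 \<or> n = 2" using that by auto
        then show ?thesis
          using tr[OF mem(1,2), of s1] tr[OF mem(3,4), of s2] tr[OF mem(5,6), of s3]
          by (elim disjE) (simp_all del: transform.simps atLeastAtMost_iff)
      qed
      then show ?thesis using that(6,7,8) by (simp add: valid_code_def del: transform.simps)
    qed
    ultimately have "reducible ?A"
      using less that(1,2) A by (intro reducibleI[of f e b ?B]) auto
    then show False using irr by simp
  qed
  \<comment> \<open>If all states act alike on letters, then all of them act alike on words.\<close>
  have const: "\<not> (s1 = s2 \<and> s2 = s3)"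
  proof
    assume s: "s1 = s2 \<and> s2 = s3"
    have "app [1, 1, 1] i = 1" if "i \<in> {1..3}" for i
      using that by (auto simp: set3)
    then have "morphism [1, 1, 1] False False [(1, 1, s1)] [1, 1, 1] ?A"
      using mem s by (simp del: app.simps)
    then have "reducible ?A"
      by (rule reducibleI[OF _ _ A]) (auto simp: valid_code_def code_less_def)
    then show False using irr by simp
  qed
  have sets: "set [3, 2, 1] = {1..3 :: int}" "set [2, 1, 3] = {1..3 :: int}"
      "set [1, 3, 2] = {1..3 :: int}" "set [1, 2, 3] = {1..3 :: int}"
    by auto
  have swap13: "\<not> code_less (map (transform [3, 2, 1] False False) [?A ! 2, ?A ! 1, ?A ! 0]) ?A"
    by (rule perm[OF refl sets(1)]) simp_all
  have swap12: "\<not> code_less (map (transform [2, 1, 3] False False) [?A ! 1, ?A ! 0, ?A ! 2]) ?A"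
    by (rule perm[OF refl sets(2)]) simp_all
  have swap23: "\<not> code_less (map (transform [1, 3, 2] False False) [?A ! 0, ?A ! 2, ?A ! 1]) ?A"
    by (rule perm[OF refl sets(3)]) simp_all
  have fixed: "\<not> code_less (map (transform [1, 2, 3] True b) [?A ! 0, ?A ! 1, ?A ! 2]) ?A" for b
    by (rule perm[OF refl sets(4)]) simp_all
  have flags: "s1 \<and> \<not> s3"
    using swap13 swap12 swap23 const
    by (cases s1; cases s2; cases s3) (simp_all add: code_less_def key_def del: app.simps)
  have id: "app [1, 2, 3] i = i" if "i \<in> {1..3}" for i
    using that by (auto simp: set3)
  have le3: "r3 \<le> l3"
    using fixed[of True] flags
    by (cases s2) (simp_all add: code_less_def key_def mem[THEN id] del: app.simps split: if_splits)
  show ?thesis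
    using fixed[of False] flags le3
    by (cases s2) (simp_all add: code_less_def key_def mem[THEN id] del: app.simps split: if_splits)
qed

section \<open>Every automaton group is the group of a code\<close>

lemma wact_Bij: "wact T w \<in> Bij UNIV"
proof -
  have "bij (wact T w)"
    by (rule o_bij[of "wact T (winv w)"]) (auto simp: fun_eq_iff)
  then show ?thesis by (simp add: Bij_def)
qed

lemma mult_BijGroup_UNIV:
  "f \<in> Bij UNIV \<Longrightarrow> g \<in> Bij UNIV \<Longrightarrow> f \<otimes>\<^bsub>BijGroup UNIV\<^esub> g = f \<circ> g"
  by (simp add: BijGroup_def compose_def fun_eq_iff)

lemma carrier_BijGroup: "carrier (BijGroup S) = Bij S"
  by (simp add: BijGroup_def)

text \<open>
  The product of the symmetric group composes from right to left and words act from left to right;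
  hence the reversed concatenation.
\<close>
lemma generate_wact:
  "generate (BijGroup UNIV) ((\<lambda>i. wact T [i]) ` I) = wact T ` words I"
proof
  interpret H: group "BijGroup (UNIV :: bool list set)" by (rule group_BijGroup)
  have inv: "inv\<^bsub>BijGroup UNIV\<^esub> (wact T w) = wact T (winv w)" for w
    by (rule H.inv_equality)
       (auto simp: mult_BijGroup_UNIV wact_Bij carrier_BijGroup, simp add: BijGroup_def fun_eq_iff)
  have mult: "wact T u \<otimes>\<^bsub>BijGroup UNIV\<^esub> wact T v = wact T (v @ u)" for u v
    by (simp add: mult_BijGroup_UNIV wact_Bij fun_eq_iff wact_append)
  have one: "\<one>\<^bsub>BijGroup UNIV\<^esub> = wact T []"
    by (simp add: BijGroup_def fun_eq_iff)
  show "generate (BijGroup UNIV) ((\<lambda>i. wact T [i]) ` I) \<subseteq> wact T ` words I"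
  proof
    fix f assume "f \<in> generate (BijGroup UNIV) ((\<lambda>i. wact T [i]) ` I)"
    then show "f \<in> wact T ` words I"
    proof induction
      case one
      then show ?case using \<open>\<one>\<^bsub>BijGroup UNIV\<^esub> = wact T []\<close> words_Nil by (metis imageI)
    next
      case (incl h)
      then show ?case by (auto simp: words_Cons)
    next
      case (inv h)
      then show ?case using \<open>\<And>w. inv\<^bsub>BijGroup UNIV\<^esub> (wact T w) = wact T (winv w)\<close>
        by (auto simp: words_Cons)
    next
      case (eng g h)
      then obtain u v where "u \<in> words I" "g = wact T u" "v \<in> words I" "h = wact T v" by blast
      then show ?case using mult words_append by auto
    qed
  qed
  show "wact T ` words I \<subseteq> generate (BijGroup UNIV) ((\<lambda>i. wact T [i]) ` I)" (is "_ \<subseteq> ?G")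
  proof (rule image_subsetI)
    fix w assume "w \<in> words I"
    then show "wact T w \<in> ?G"
    proof (induction w)
      case Nil
      then show ?case using generate.one[of "BijGroup UNIV"] one by metis
    next
      case (Cons l w)
      have "wact T [l] \<in> ?G"
      proof (cases "l \<in> I")
        case True
        then show ?thesis by (intro generate.incl) auto
      next
        case False
        then have "- l \<in> I" using Cons.prems by (auto simp: words_Cons)
        then have "inv\<^bsub>BijGroup UNIV\<^esub> (wact T [- l]) \<in> ?G" by (intro generate.inv) auto
        then show ?thesis by (simp add: inv)
      qed
      moreover have "wact T w \<in> ?G" using Cons by (auto simp: words_Cons)
      ultimately show ?case using generate.eng[of "wact T w" "BijGroup UNIV" _ "wact T [l]"] mult[of w "[l]"]
        by (metis append_Cons append_Nil)
    qed
  qed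
qed

text \<open>
  Identifying the states with 1, 2, 3 and the letters with False and True transports the action on
  words. The isomorphism is conjugation by the letterwise bijection.
\<close>
lemma automaton_group_code:
  fixes A :: "('q, 'x) automaton"
  assumes inv: "invertible_automaton A" and Q: "card (states A) = 3" and X: "card (alphabet A) = 2"
  shows "\<exists>C. valid_code C \<and> length C = 3 \<and> automaton_group A \<cong> code_group C"
proof -
  obtain q1 q2 q3 where q: "states A = {q1, q2, q3}" "q1 \<noteq> q2" "q1 \<noteq> q3" "q2 \<noteq> q3"
    using Q by (auto simp: card_3_iff)
  obtain x0 x1 where x: "alphabet A = {x0, x1}" "x0 \<noteq> x1"
    using X by (auto simp: card_2_iff)
  define ix :: "'q \<Rightarrow> int" where "ix p = (if p = q1 then 1 else if p = q2 then 2 else 3)" for p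
  define bit where "bit y \<longleftrightarrow> y = x1" for y
  define letter where "letter y = (if y then x1 else x0)" for y
  define st where "st p = (ix (transition_fun A p x0), ix (transition_fun A p x1), output_fun A p x0 = x1)" for p
  define C where "C = [st q1, st q2, st q3]"
  let ?T = "table 0 C"
  have tr: "transition_fun A p y \<in> states A" if "p \<in> states A" "y \<in> alphabet A" for p y
    using inv that by (auto simp: invertible_automaton_def)
  have ix: "ix p \<in> {1..3}" for p by (simp add: ix_def)
  have valid: "valid_code C" using ix by (simp add: valid_code_def C_def st_def)
  have entry: "entry ?T (ix p) = ([ix (transition_fun A p x0)], [ix (transition_fun A p x1)], output_fun A p x0 = x1)"
    if "p \<in> states A" for p
    using that q by (auto simp: C_def st_def ix_def)
  have out: "bit (output_fun A p y) = (bit y \<noteq> (output_fun A p x0 = x1))"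
    if "p \<in> states A" "y \<in> alphabet A" for p y
  proof -
    have "bij_betw (output_fun A p) {x0, x1} {x0, x1}"
      using inv that x by (auto simp: invertible_automaton_def)
    then have "output_fun A p x0 \<noteq> output_fun A p x1" "output_fun A p x0 \<in> {x0, x1}"
        "output_fun A p x1 \<in> {x0, x1}"
      using x(2) by (auto simp: bij_betw_def inj_on_def)
    then show ?thesis using that(2) x by (auto simp: bit_def)
  qed
  have bl: "letter (bit y) = y" if "y \<in> alphabet A" for y
    using that x by (auto simp: bit_def letter_def)
  have lb: "bit (letter y) = y" for y using x by (auto simp: bit_def letter_def)
  have lX: "letter y \<in> alphabet A" for y using x by (simp add: letter_def)
  have Bl: "map letter (map bit w) = w" if "w \<in> lists (alphabet A)" for w
    using that bl by (induction w) auto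
  have Lb: "map bit (map letter w) = w" for w using lb by (induction w) auto
  have LX: "map letter w \<in> lists (alphabet A)" for w using lX by (induction w) auto
  have act: "map bit (act A p w) = wact ?T [ix p] (map bit w)"
    if "p \<in> states A" "w \<in> lists (alphabet A)" for p w
    using that(2,1)
  proof (induction w arbitrary: p rule: list.induct)
    case (Cons y w)
    have y: "y \<in> alphabet A" "w \<in> lists (alphabet A)" using Cons.prems by auto
    have pos: "0 \<le> ix p" using ix[of p] by auto
    have "lsec ?T (ix p) (bit y) = [ix (transition_fun A p y)]"
      using entry[OF Cons.prems(2)] pos y x by (auto simp: lsec_def side_def bit_def)
    moreover have "active ?T (ix p) = (output_fun A p x0 = x1)"
      using entry[OF Cons.prems(2)] pos by (simp add: active_def)
    ultimately show ?case
      using Cons.IH[OF y(2) tr[OF Cons.prems(2) y(1)]] out[OF Cons.prems(2) y(1)] by simp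
  qed simp
  let ?G = "tree_aut_group (alphabet A)" and ?H = "BijGroup (UNIV :: bool list set)"
  let ?S = "state_aut A ` states A"
  define \<Psi> where "\<Psi> h = map bit \<circ> h \<circ> map letter" for h
  have carrier_G: "h \<in> Bij (lists (alphabet A))" if "h \<in> carrier ?G" for h
    using that by (simp add: tree_aut_group_def tree_automorphisms_def)
  have memX: "h w \<in> lists (alphabet A)" if "h \<in> carrier ?G" "w \<in> lists (alphabet A)" for h w
    using funcset_mem[OF Bij_imp_funcset[OF carrier_G[OF that(1)]] that(2)] .
  have mult_G: "f \<otimes>\<^bsub>?G\<^esub> g = compose (lists (alphabet A)) f g"
    if "f \<in> carrier ?G" "g \<in> carrier ?G" for f g
    using carrier_G[OF that(1)] carrier_G[OF that(2)] by (simp add: tree_aut_group_def BijGroup_def)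
  have \<Psi>_mult: "\<Psi> (f \<otimes>\<^bsub>?G\<^esub> g) = \<Psi> f \<circ> \<Psi> g"
    if "f \<in> carrier ?G" "g \<in> carrier ?G" for f g
  proof
    fix w
    have "map letter (map bit (g (map letter w))) = g (map letter w)"
      by (rule Bl[OF memX[OF that(2) LX]])
    then show "\<Psi> (f \<otimes>\<^bsub>?G\<^esub> g) w = (\<Psi> f \<circ> \<Psi> g) w"
      using LX[of w] by (simp add: \<Psi>_def mult_G[OF that] compose_def del: map_map)
  qed
  have \<Psi>_Bij: "\<Psi> h \<in> Bij UNIV" if "h \<in> carrier ?G" for h
  proof -
    have b: "bij_betw h (lists (alphabet A)) (lists (alphabet A))"
      using carrier_G[OF that] by (simp add: Bij_def)
    have "bij_betw (map letter) UNIV (lists (alphabet A))"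
      by (rule bij_betw_byWitness[where f' = "map bit"]) (use Bl Lb LX in auto)
    moreover have "bij_betw (map bit) (lists (alphabet A)) UNIV"
      by (rule bij_betw_byWitness[where f' = "map letter"]) (use Bl Lb LX in auto)
    ultimately have "bij (\<Psi> h)" unfolding \<Psi>_def by (meson b bij_betw_trans)
    then show ?thesis by (simp add: Bij_def)
  qed
  have hom: "\<Psi> \<in> hom ?G ?H"
    by (rule homI) (simp_all add: carrier_BijGroup \<Psi>_Bij \<Psi>_mult mult_BijGroup_UNIV)
  interpret gh: group_hom ?G ?H \<Psi>
    using hom by (simp add: group_hom_def group_hom_axioms_def group_tree_aut_group group_BijGroup)
  have S: "?S \<subseteq> carrier ?G" using state_aut_closed[OF inv] by blast
  have \<Psi>_state: "\<Psi> (state_aut A p) = wact ?T [ix p]" if "p \<in> states A" for p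
  proof
    fix w
    show "\<Psi> (state_aut A p) w = wact ?T [ix p] w"
      using act[OF that LX[of w]] LX[of w] Lb[of w] by (simp add: \<Psi>_def state_aut_def del: map_map)
  qed
  have "ix ` states A = {1..3}"
  proof -
    have "{1..3 :: int} = {1, 2, 3}" by auto
    then show ?thesis using q by (auto simp: ix_def)
  qed
  then have "\<Psi> ` ?S = (\<lambda>i. wact ?T [i]) ` {1..3}"
    using \<Psi>_state by (metis (no_types, lifting) image_cong image_image)
  then have image: "\<Psi> ` carrier (automaton_group A) = carrier (code_group C)"
    using gh.generate_img[OF S] generate_wact[of ?T "{1..3}"]
    by (simp add: carrier_automaton_group[OF inv] code_group_def wgroup_def C_def)
  have sub: "carrier (automaton_group A) \<subseteq> carrier ?G"
    using group.generate_incl[OF group_tree_aut_group S] by (simp add: carrier_automaton_group[OF inv])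
  have "inj_on \<Psi> (carrier (automaton_group A))"
  proof (rule inj_onI)
    fix f g assume fg: "f \<in> carrier (automaton_group A)" "g \<in> carrier (automaton_group A)" "\<Psi> f = \<Psi> g"
    have "f w = g w" if w: "w \<in> lists (alphabet A)" for w
    proof -
      have "map bit (f w) = map bit (g w)"
        using fun_cong[OF fg(3), of "map bit w"] Bl[OF w] by (simp add: \<Psi>_def del: map_map)
      then have "map letter (map bit (f w)) = map letter (map bit (g w))" by simp
      moreover have "f \<in> carrier ?G" "g \<in> carrier ?G" using fg(1,2) sub by auto
      ultimately show ?thesis using Bl[OF memX[OF _ w]] by simp
    qed
    moreover have "f \<in> Bij (lists (alphabet A))" "g \<in> Bij (lists (alphabet A))"
      using carrier_G subsetD[OF sub] fg by blast+
    then have "f \<in> extensional (lists (alphabet A))" "g \<in> extensional (lists (alphabet A))"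
      by (simp_all add: Bij_imp_extensional)
    ultimately show "f = g" using extensionalityI[of f "lists (alphabet A)" g] by simp
  qed
  moreover have "\<Psi> \<in> hom (automaton_group A) (code_group C)"
  proof (rule homI)
    fix f g assume "f \<in> carrier (automaton_group A)" "g \<in> carrier (automaton_group A)"
    then have "\<Psi> (f \<otimes>\<^bsub>?G\<^esub> g) = \<Psi> f \<circ> \<Psi> g" using sub \<Psi>_mult by blast
    then show "\<Psi> (f \<otimes>\<^bsub>automaton_group A\<^esub> g) = \<Psi> f \<otimes>\<^bsub>code_group C\<^esub> \<Psi> g"
      by (simp add: automaton_group_def code_group_def wgroup_def)
  qed (use image in blast)
  ultimately have "automaton_group A \<cong> code_group C"
    using image by (auto simp: is_iso_def iso_def bij_betw_def)
  then show ?thesis using valid by (auto simp: C_def)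
qed

section \<open>Representatives, merged codes and their certificates\<close>

text \<open>
  The 195 codes that none of the symmetries and quotients makes smaller, divided into those that
  represent the isomorphism classes and those that certificates connect to them. The latter are
  listed in order of their distance from the representative in a tree of certificates, so that each
  certificate refers to a representative or to a code treated before.
\<close>
definition representatives :: "code list" where "representatives = [
  [(1,1,False)], [(1,1,True),(2,2,False)], [(1,1,True),(1,2,False),(2,1,False)],
  [(1,1,True),(1,3,False),(2,1,False)], [(1,1,True),(2,3,False),(2,1,False)],
  [(1,1,True),(2,3,False),(3,1,False)], [(1,1,True),(3,1,False),(1,1,False)],
  [(1,1,True),(3,2,False),(2,1,False)], [(1,1,True),(3,3,False),(2,1,False)],
  [(1,1,True),(3,1,True),(2,1,False)], [(1,1,True),(3,2,True),(1,1,False)],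
  [(1,2,True),(3,1,True),(1,1,False)], [(1,2,True),(3,1,True),(3,1,False)],
  [(1,2,True),(3,2,True),(1,1,False)], [(1,2,True),(3,2,True),(3,1,False)],
  [(1,3,True),(2,1,True),(1,1,False)], [(1,3,True),(2,1,True),(2,1,False)],
  [(1,3,True),(3,1,True),(1,1,False)], [(1,3,True),(3,1,True),(2,1,False)],
  [(1,3,True),(3,1,True),(3,3,False)], [(1,3,True),(3,2,True),(1,1,False)],
  [(1,3,True),(3,2,True),(2,1,False)], [(1,3,True),(3,2,True),(3,1,False)],
  [(1,3,True),(3,2,True),(3,3,False)], [(2,1,True),(1,2,False),(2,1,False)],
  [(2,1,True),(1,3,False),(2,1,False)], [(2,1,True),(2,1,False),(1,1,False)],
  [(2,1,True),(2,2,False),(3,1,False)], [(2,1,True),(2,3,False),(2,1,False)],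
  [(2,1,True),(2,3,False),(3,1,False)], [(2,1,True),(3,1,False),(1,1,False)],
  [(2,1,True),(3,2,False),(1,1,False)], [(2,1,True),(3,2,False),(2,1,False)],
  [(2,1,True),(3,2,False),(3,1,False)], [(2,1,True),(3,3,False),(1,1,False)],
  [(2,1,True),(3,3,False),(2,1,False)], [(2,1,True),(3,3,False),(3,1,False)],
  [(2,1,True),(3,1,True),(1,1,False)], [(2,1,True),(3,1,True),(3,1,False)],
  [(2,1,True),(3,2,True),(1,1,False)], [(2,1,True),(3,2,True),(3,1,False)],
  [(2,1,True),(3,3,True),(1,1,False)], [(2,1,True),(3,3,True),(3,1,False)],
  [(2,2,True),(1,2,False),(2,1,False)], [(2,2,True),(1,2,False),(3,1,False)],
  [(2,2,True),(1,3,False),(2,1,False)], [(2,2,True),(2,1,False),(1,1,False)],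
  [(2,2,True),(2,2,False),(1,1,False)], [(2,2,True),(2,3,False),(2,1,False)],
  [(2,2,True),(2,3,False),(3,1,False)], [(2,2,True),(3,1,False),(1,1,False)],
  [(2,2,True),(3,2,False),(1,1,False)], [(2,2,True),(3,2,False),(2,1,False)],
  [(2,2,True),(3,2,False),(3,1,False)], [(2,2,True),(3,3,False),(1,1,False)],
  [(2,2,True),(3,3,False),(2,1,False)], [(2,2,True),(3,3,False),(3,1,False)],
  [(2,2,True),(3,1,True),(1,1,False)], [(2,2,True),(3,1,True),(3,1,False)],
  [(2,2,True),(3,2,True),(1,1,False)], [(2,2,True),(3,2,True),(3,1,False)],
  [(2,2,True),(3,3,True),(3,1,False)], [(2,3,True),(2,1,True),(1,1,False)],
  [(2,3,True),(2,1,True),(2,1,False)], [(2,3,True),(2,1,True),(3,1,False)],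
  [(2,3,True),(3,1,True),(1,1,False)], [(2,3,True),(3,1,True),(2,1,False)],
  [(2,3,True),(3,1,True),(3,1,False)], [(2,3,True),(3,2,True),(1,1,False)],
  [(2,3,True),(3,2,True),(3,1,False)], [(3,1,True),(1,2,False),(2,1,False)],
  [(3,1,True),(2,2,False),(2,1,False)], [(3,1,True),(2,3,False),(2,1,False)],
  [(3,1,True),(3,2,False),(1,1,False)], [(3,1,True),(3,2,False),(2,1,False)],
  [(3,1,True),(3,2,False),(3,1,False)], [(3,1,True),(3,3,False),(2,1,False)],
  [(3,1,True),(1,1,True),(1,1,False)], [(3,1,True),(1,1,True),(2,1,False)],
  [(3,1,True),(1,1,True),(3,3,False)], [(3,1,True),(2,1,True),(1,1,False)],
  [(3,1,True),(2,1,True),(2,1,False)], [(3,1,True),(2,2,True),(1,1,False)],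
  [(3,1,True),(2,2,True),(2,1,False)], [(3,2,True),(1,2,False),(2,1,False)],
  [(3,2,True),(1,3,False),(2,1,False)], [(3,2,True),(2,1,False),(1,1,False)],
  [(3,2,True),(2,2,False),(1,1,False)], [(3,2,True),(2,2,False),(2,1,False)],
  [(3,2,True),(2,2,False),(3,1,False)], [(3,2,True),(2,3,False),(2,1,False)],
  [(3,2,True),(2,3,False),(3,1,False)], [(3,2,True),(3,1,False),(1,1,False)],
  [(3,2,True),(3,2,False),(1,1,False)], [(3,2,True),(3,2,False),(2,1,False)],
  [(3,2,True),(3,2,False),(3,1,False)], [(3,2,True),(3,3,False),(1,1,False)],
  [(3,2,True),(3,3,False),(2,1,False)], [(3,2,True),(3,3,False),(3,1,False)],
  [(3,2,True),(1,1,True),(1,1,False)], [(3,2,True),(1,1,True),(2,1,False)],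
  [(3,2,True),(1,1,True),(3,1,False)], [(3,2,True),(1,1,True),(3,3,False)],
  [(3,2,True),(2,1,True),(1,1,False)], [(3,2,True),(2,1,True),(2,1,False)],
  [(3,2,True),(2,1,True),(3,1,False)], [(3,2,True),(2,2,True),(1,1,False)],
  [(3,2,True),(2,2,True),(3,1,False)], [(3,2,True),(3,3,True),(1,1,False)],
  [(3,2,True),(3,3,True),(3,1,False)], [(3,3,True),(1,2,False),(2,1,False)],
  [(3,3,True),(2,2,False),(2,1,False)], [(3,3,True),(2,3,False),(3,1,False)],
  [(3,3,True),(3,2,False),(2,1,False)], [(3,3,True),(3,2,False),(3,1,False)],
  [(3,3,True),(3,3,False),(2,1,False)], [(3,3,True),(1,1,True),(2,1,False)],
  [(3,3,True),(2,1,True),(1,1,False)], [(3,3,True),(2,1,True),(2,1,False)],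
  [(3,3,True),(2,1,True),(3,1,False)], [(3,3,True),(2,1,True),(3,3,False)],
  [(3,3,True),(2,2,True),(2,1,False)], [(3,3,True),(3,1,True),(2,1,False)],
  [(3,3,True),(3,2,True),(2,1,False)]]"

definition merged_codes :: "code list" where "merged_codes = [
  [(1,1,True)], [(2,2,True),(2,2,False)], [(3,3,True),(2,2,True),(3,1,False)],
  [(3,1,True),(2,2,True),(3,3,False)], [(1,1,True),(2,1,False)], [(1,1,True),(2,2,False),(3,1,False)],
  [(2,2,True),(2,1,False)], [(1,1,True),(1,2,False),(3,1,False)], [(1,1,True),(3,3,True),(3,1,False)],
  [(2,2,True),(2,2,False),(3,1,False)], [(3,3,True),(2,2,False),(3,1,False)],
  [(3,3,True),(1,1,True),(3,1,False)], [(1,1,True),(1,1,False)], [(3,3,True),(1,1,True),(3,3,False)],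
  [(1,1,True),(2,2,False),(1,1,False)], [(2,2,True),(1,1,False)], [(3,3,True),(2,2,True),(3,3,False)],
  [(3,3,True),(2,2,False),(1,1,False)], [(3,3,True),(2,2,True),(1,1,False)],
  [(2,2,True),(3,3,True),(1,1,False)], [(2,1,True),(2,1,False)], [(3,1,True),(2,2,False),(3,1,False)],
  [(3,1,True),(2,2,True),(3,1,False)], [(1,3,True),(3,1,True),(3,1,False)], [(2,1,True),(2,2,False)],
  [(2,1,True),(2,2,False),(1,1,False)], [(2,1,True),(1,1,False)], [(3,1,True),(2,2,False),(1,1,False)],
  [(3,1,True),(3,3,False),(1,1,False)], [(2,3,True),(3,1,True),(3,3,False)],
  [(3,1,True),(3,3,False),(3,1,False)], [(3,1,True),(1,1,True),(3,1,False)],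
  [(3,1,True),(3,3,True),(3,1,False)], [(3,1,True),(2,3,False),(3,1,False)],
  [(3,1,True),(2,1,True),(3,1,False)], [(1,3,True),(2,1,True),(3,1,False)],
  [(2,1,True),(2,2,False),(2,1,False)], [(3,3,True),(3,2,True),(3,3,False)],
  [(3,1,True),(2,1,True),(3,3,False)], [(1,3,True),(2,1,True),(3,3,False)],
  [(1,1,True),(2,2,False),(2,1,False)], [(2,2,True),(2,2,False),(2,1,False)],
  [(3,3,True),(3,1,True),(3,3,False)], [(1,1,True),(3,1,True),(3,3,False)],
  [(1,1,True),(3,2,True),(3,1,False)], [(1,1,True),(3,2,False),(3,1,False)],
  [(3,3,True),(3,1,True),(3,1,False)], [(3,3,True),(3,3,False),(3,1,False)],
  [(1,1,True),(3,1,True),(3,1,False)], [(1,1,True),(2,1,False),(1,1,False)],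
  [(1,1,True),(3,3,False),(3,1,False)], [(3,3,True),(2,1,False),(1,1,False)],
  [(3,3,True),(3,2,True),(1,1,False)], [(1,1,True),(3,3,False),(1,1,False)],
  [(3,3,True),(3,3,False),(1,1,False)], [(1,1,True),(3,3,True),(1,1,False)],
  [(3,3,True),(1,1,True),(1,1,False)], [(2,3,True),(2,1,True),(3,3,False)],
  [(3,3,True),(3,1,False),(1,1,False)], [(1,1,True),(3,1,True),(1,1,False)],
  [(3,3,True),(3,1,True),(1,1,False)], [(3,1,True),(2,1,False),(1,1,False)],
  [(3,1,True),(3,3,True),(1,1,False)], [(3,1,True),(3,1,False),(1,1,False)],
  [(3,3,True),(3,2,True),(3,1,False)], [(3,3,True),(3,2,False),(1,1,False)],
  [(1,1,True),(3,2,False),(1,1,False)], [(2,1,True),(1,2,False),(3,1,False)],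
  [(3,3,True),(2,3,False),(2,1,False)], [(3,2,True),(1,2,False),(3,1,False)],
  [(3,2,True),(2,1,True),(3,3,False)]]"

type_synonym certificate =
  "code \<times> code \<times> recursion \<times> word \<times> (word \<times> trace) list \<times> (word \<times> trace) list \<times> (word \<times> trace \<times> trace) list"

text \<open>
  For example, the second certificate relates a = \<sigma>(b, b), b = (b, b) (symbols 1 and 2), where b
  acts trivially, to e = \<sigma>(e, e) (symbol 3). The conjugator is d = (1, b\<inverse> e) (symbol 4), and the
  relators are b, e e and a d e\<inverse> d\<inverse>. The section of the last one at True is b e\<inverse> e\<inverse> b; its trace
  inserts e e after the first letter and then cancels each of the two remaining letters b. Its
  section at False vanishes by free cancellation.
\<close>
definition certificates :: "certificate list" where "certificates = [
  ([(1,1,True)], [(1,1,True),(2,2,False)], [], [],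
    [([2],[(0,-2,0)])],
    [([1],[(0,-2,0)]), ([],[(0,1,0)])],
    [([3],[(0,-1,0)],[(0,-1,0)]), ([1,-2],[(0,-2,0)],[(0,-2,0)])]),
  ([(2,2,True),(2,2,False)], [(1,1,True)], [([],[-2,3],False)], [4],
    [([3],[(0,-3,0)]), ([],[(0,-1,0)])],
    [([1],[(0,-3,0)])],
    [([2],[(0,-1,0)],[(0,-1,0)]), ([3,3],[(0,-2,0)],[(0,-2,0)]), ([1,4,-3,-4],[],[(1,2,0),(0,-1,0),(0,-1,0)])]),
  ([(3,3,True),(2,2,True),(3,1,False)], [(3,1,True),(2,2,True),(1,1,False)], [], [],
    [([5,6],[(0,-1,0)]), ([5],[(0,-2,0)]), ([5,4],[(0,-3,0)])],
    [([2,3],[(0,-4,0)]), ([2],[(0,-2,0)]), ([2,1],[(0,-5,0)])],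
    [([1,-6,-5],[(0,-3,0)],[(0,-3,0)]), ([2,-5],[(0,-2,0)],[(0,-2,0)]), ([3,-4,-5],[(0,-3,0)],[(0,-1,0)]),
     ([2,3,-4],[(0,-5,0)],[(0,-4,0)]), ([2,1,-6],[(0,-4,0)],[(0,-4,0)])]),
  ([(3,1,True),(2,2,True),(3,3,False)], [(3,1,True),(2,2,True),(1,1,False)], [([2,7,4],[1,2,7],False)], [7],
    [([4],[(0,-1,0)]), ([5],[(0,-2,0)]), ([],[(0,-3,0)])],
    [([1],[(0,-1,0)]), ([2],[(0,-2,0)]), ([-1,-1],[(0,-4,0)])],
    [([1,7,-4,-7],[(5,-1,2),(3,-4,3),(1,-5,0),(0,-3,0)],[]),
     ([2,7,-5,-7],[(2,-2,0),(1,-1,0)],[(2,1,0),(3,-2,3),(1,-5,3),(0,5,0)]), ([3],[(0,-3,0)],[(0,-3,0)]),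
     ([-1,-1,7,-6,-7],[(3,-1,3),(2,5,0),(1,3,0)],[(2,-1,3),(1,5,0),(0,3,0)]),
     ([1,2,1,-2],[(0,-3,0),(1,-3,0)],[(0,-5,0)])]),
  ([(1,1,True),(2,1,False)], [(3,1,True),(2,2,True),(3,3,False)], [], [],
    [([4],[(0,-3,0)]), ([-3,4],[(0,-4,0)])],
    [([-1,-2],[(0,-5,0)]), ([1],[(0,-3,0)]), ([],[(0,2,0)])],
    [([1,1],[(0,-1,0)],[(0,-1,0)]), ([5],[(0,-2,0)],[(0,-2,0)]), ([1,-4],[(0,-3,0)],[(0,-3,0)]),
     ([2,-4,3],[(0,-4,0)],[(0,-3,0),(0,-2,0)]), ([-1,-2,-3],[(0,1,0),(0,2,0)],[(0,-5,0)])]),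
  ([(1,1,True),(2,2,False),(3,1,False)], [(1,1,True),(2,1,False)], [], [],
    [([4],[(0,-1,0)]), ([],[(0,-2,0)]), ([5],[(0,-3,0)])],
    [([1],[(0,-1,0)]), ([3],[(0,-3,0)])],
    [([1,-4],[(0,-1,0)],[(0,-1,0)]), ([2],[(0,-2,0)],[(0,-2,0)]), ([3,-5],[(0,-3,0)],[(0,-1,0)])]),
  ([(2,2,True),(2,1,False)], [(1,1,True),(2,1,False)], [([5,-4],[-2,5,-4,3],False)], [5],
    [([3],[(0,-1,0)]), ([4],[(0,-2,0)])],
    [([1],[(0,-1,0)]), ([2],[(0,-2,0)])],
    [([1,5,-3,-5],[],[(0,-2,0),(0,-1,3),(1,-1,3),(2,2,0),(0,-3,0)]),
     ([2,5,-4,-5],[(0,-2,0)],[(0,3,1),(1,-2,0),(1,-1,3),(2,2,0),(0,-3,0)]), ([-1,-1,2,2],[],[(0,3,0)])]),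
  ([(1,1,True),(1,2,False),(3,1,False)], [(1,1,True),(2,1,False)], [], [],
    [([4],[(0,-2,0)]), ([4,5,4],[(0,-3,0)]), ([5],[(0,-4,0)])],
    [([1],[(0,-2,0)]), ([3],[(0,-4,0)])],
    [([4,4],[(0,-1,0)],[(0,-1,0)]), ([1,-4],[(0,-2,0)],[(0,-2,0)]),
     ([2,-4,-5,-4],[(0,-2,0),(0,1,0)],[(0,-3,0)]), ([3,-5],[(0,-4,0)],[(0,-2,0)])]),
  ([(1,1,True),(3,3,True),(3,1,False)], [(1,1,True),(2,1,False)], [], [],
    [([4],[(0,-2,0)]), ([5,4,5],[(0,-3,0)]), ([5],[(0,-4,0)])],
    [([1],[(0,-2,0)]), ([3],[(0,-4,0)])],
    [([4,4],[(0,-1,0)],[(0,-1,0)]), ([1,-4],[(0,-2,0)],[(0,-2,0)]),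
     ([2,-5,-4,-5],[(1,1,0),(0,-4,0)],[(0,-4,0),(0,1,0)]), ([3,-5],[(0,-4,0)],[(0,-2,0)])]),
  ([(2,2,True),(2,2,False),(3,1,False)], [(1,1,True),(2,1,False)], [([6],[-2,6,4],False)], [6],
    [([4],[(0,-3,0)]), ([],[(0,-1,0)]), ([5],[(0,-4,0)])],
    [([1],[(0,-3,0)]), ([3],[(0,-4,0)])],
    [([2],[(0,-1,0)],[(0,-1,0)]), ([1,1],[(0,-1,0),(0,-1,0)],[(0,-1,0),(0,-1,0)]),
     ([1,6,-4,-6],[],[(1,-3,3),(2,-3,3),(1,2,0),(0,-1,0),(0,-1,0)]),
     ([3,6,-5,-6],[(0,-4,0)],[(2,-3,3),(0,-2,0),(1,1,0),(0,2,0),(0,-1,0)])]),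
  ([(3,3,True),(2,2,False),(3,1,False)], [(2,2,True),(2,1,False)], [], [],
    [([4],[(0,-1,0)]), ([],[(0,-2,0)]), ([5],[(0,-3,0)])],
    [([1],[(0,-1,0)]), ([3],[(0,-3,0)])],
    [([1,-4],[(0,-3,0)],[(0,-3,0)]), ([2],[(0,-2,0)],[(0,-2,0)]), ([3,-5],[(0,-3,0)],[(0,-1,0)])]),
  ([(3,3,True),(1,1,True),(3,1,False)], [(2,2,True),(2,1,False)], [], [],
    [([4],[(0,-3,0)]), ([5,4,5],[(0,-4,0)]), ([5],[(0,-5,0)])],
    [([1],[(0,-3,0)]), ([3],[(0,-5,0)])],
    [([4,4],[(0,-2,0)],[(0,-2,0)]), ([5,5],[(0,-2,0)],[(0,-1,0)]), ([1,-4],[(0,-5,0)],[(0,-5,0)]),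
     ([2,-5,-4,-5],[(0,-3,0),(0,2,0)],[(1,2,0),(0,-3,0)]), ([3,-5],[(0,-5,0)],[(0,-3,0)])]),
  ([(1,1,True),(1,1,False)], [(2,2,True),(2,2,False),(1,1,False)], [([6],[-1,6,4],False)], [6],
    [([3],[(0,-3,0)]), ([5],[(0,-4,0)])],
    [([1],[(0,-3,0)]), ([],[(1,2,0)]), ([2],[(0,-4,0)])],
    [([1,1],[(0,-1,0)],[(0,-1,0)]), ([4],[(0,-2,0)],[(0,-2,0)]), ([1,6,-3,-6],[],[(0,-1,0),(2,2,0),(2,2,0)]),
     ([2,6,-5,-6],[(0,-3,0)],[(1,-2,0),(0,-3,3),(2,2,0)])]),
  ([(3,3,True),(1,1,True),(3,3,False)], [(2,2,True),(2,2,False),(1,1,False)], [], [],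
    [([4],[(0,-3,0)]), ([4,6],[(0,-4,0)]), ([],[(0,-1,0)])],
    [([1],[(0,-3,0)]), ([],[(0,2,0)]), ([1,2],[(0,-5,0)])],
    [([3],[(0,-1,0)],[(0,-1,0)]), ([5],[(0,-2,0)],[(0,-2,0)]), ([1,-4],[(0,-1,0),(0,2,0)],[(0,-1,0),(0,2,0)]),
     ([2,-6,-4],[(0,-3,0),(0,2,0)],[(0,-3,0),(0,2,0)]), ([1,2,-6],[(1,-3,0),(0,-1,0)],[(1,-3,0),(0,-1,0)])]),
  ([(1,1,True),(2,2,False),(1,1,False)], [(1,1,True),(1,1,False)], [], [],
    [([4],[(0,-1,0)]), ([],[(0,-2,0)]), ([5],[(0,-3,0)])],
    [([1],[(0,-1,0)]), ([3],[(0,-3,0)])],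
    [([1,-4],[(0,-1,0)],[(0,-1,0)]), ([2],[(0,-2,0)],[(0,-2,0)]), ([3,-5],[(0,-1,0)],[(0,-1,0)])]),
  ([(2,2,True),(1,1,False)], [(1,1,True),(1,1,False)], [([5],[-2,5,3],False)], [5],
    [([3],[(0,-1,0)]), ([4],[(0,-2,0)])],
    [([1],[(0,-1,0)]), ([2],[(0,-2,0)])],
    [([1,5,-3,-5],[],[(1,-1,3),(2,-1,3),(0,-3,0)]), ([2,5,-4,-5],[(0,-1,0)],[(2,-1,3),(0,4,1)]),
     ([2,-1,-1,2],[(0,3,2)],[(0,3,2)]), ([-1,-2,1,2],[(0,4,0)],[(0,4,0)])]),
  ([(3,3,True),(2,2,True),(3,3,False)], [(1,1,True),(1,1,False)], [([],[-3,4],False)], [6],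
    [([4],[(0,-1,0)]), ([4,5],[(0,-2,0)]), ([],[(0,-3,0)])],
    [([1],[(0,-1,0)]), ([1,2],[(0,-4,0)])],
    [([1,6,-4,-6],[],[(1,-5,0),(0,-3,0),(0,-3,0)]),
     ([2,6,-5,-4,-6],[(1,3,0),(0,-6,0)],[(0,-6,0),(0,-5,0),(0,-3,0)]), ([3],[(0,-3,0)],[(0,-3,0)]),
     ([1,2,6,-5,-6],[(1,-6,0),(0,-3,0)],[(0,-3,0),(1,3,0),(0,-6,0),(0,-3,0)]),
     ([-4,-4],[(0,-5,0)],[(0,-5,0)]), ([2,-4],[(0,-6,0)],[(0,-6,0)])]),
  ([(3,3,True),(2,2,False),(1,1,False)], [(2,2,True),(1,1,False)], [], [],
    [([4],[(0,-1,0)]), ([],[(0,-2,0)]), ([5],[(0,-3,0)])],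
    [([1],[(0,-1,0)]), ([3],[(0,-3,0)])],
    [([1,-4],[(0,-3,0)],[(0,-3,0)]), ([2],[(0,-2,0)],[(0,-2,0)]), ([3,-5],[(0,-1,0)],[(0,-1,0)])]),
  ([(3,3,True),(2,2,True),(1,1,False)], [(2,2,True),(1,1,False)], [], [],
    [([4],[(0,-1,0)]), ([5,4],[(0,-2,0)]), ([5],[(0,-3,0)])],
    [([1],[(0,-1,0)]), ([3],[(0,-3,0)])],
    [([1,-4],[(0,-3,0)],[(0,-3,0)]), ([2,-4,-5],[(0,-4,0)],[(0,-4,0)]), ([3,-5],[(0,-1,0)],[(0,-1,0)]),
     ([2,-5,-4],[(0,-2,0)],[(0,-2,0)])]),
  ([(2,2,True),(3,3,True),(1,1,False)], [(2,2,True),(1,1,False)], [([6],[-2,6,5],False)], [6],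
    [([4],[(0,-1,0)]), ([5,4],[(0,-2,0)]), ([5],[(0,-3,0)])],
    [([1],[(0,-1,0)]), ([3],[(0,-3,0)])],
    [([1,6,-4,-6],[],[(3,-2,2),(1,-3,3),(2,1,0),(0,-4,0)]),
     ([2,6,-4,-5,-6],[(2,-1,3),(0,4,2)],[(3,-2,3),(0,-3,0)]),
     ([3,6,-5,-6],[(0,-1,0)],[(4,-2,3),(1,2,1),(0,-1,0)]), ([2,-3,1],[(0,-5,0)],[(0,-5,0)]),
     ([3,-1,2],[(0,-6,0)],[(0,-6,0)]), ([1,-2,3],[(0,-4,0)],[(0,-4,0)])]),
  ([(2,1,True),(2,1,False)], [(2,1,True),(1,2,False),(2,1,False)], [([2,6],[6,4],False)], [6],
    [([3],[(0,-1,0)]), ([-3,4,3],[(0,-2,0)])],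
    [([1],[(0,-1,0)]), ([1,2,-1],[(0,-3,0)]), ([1,1,2,-1,-1],[(0,-4,0)])],
    [([1,6,-3,-6],[],[(1,-2,0),(0,-1,0)]), ([2,6,-3,-4,3,-6],[(1,-2,0)],[(0,-1,0)]),
     ([1,2,-1,6,-4,-6],[(1,-1,0)],[(0,-3,0)]), ([1,1,2,-1,-1,6,-5,-6],[(1,-3,0)],[(2,3,3),(1,-2,0),(0,-1,0)])]),
  ([(3,1,True),(2,2,False),(3,1,False)], [(2,1,True),(2,1,False)], [], [],
    [([4],[(0,-1,0)]), ([],[(0,-2,0)]), ([5],[(0,-3,0)])],
    [([1],[(0,-1,0)]), ([3],[(0,-3,0)])],
    [([1,-4],[(0,-3,0)],[(0,-1,0)]), ([2],[(0,-2,0)],[(0,-2,0)]), ([3,-5],[(0,-3,0)],[(0,-1,0)])]),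
  ([(3,1,True),(2,2,True),(3,1,False)], [(2,1,True),(2,1,False)], [], [],
    [([4],[(0,-2,0)]), ([5,-4],[(0,-3,0)]), ([5],[(0,-4,0)])],
    [([1],[(0,-2,0)]), ([3],[(0,-4,0)])],
    [([4,-5,4,-5],[],[]), ([1,-4],[(0,-4,0)],[(0,-2,0)]), ([2,4,-5],[(0,-3,0)],[(1,1,0),(0,-3,0)]),
     ([3,-5],[(0,-4,0)],[(0,-2,0)])]),
  ([(1,3,True),(3,1,True),(3,1,False)], [(2,1,True),(2,1,False)], [([6,-5],[6,-4],False)], [6],
    [([4],[(0,-1,0)]), ([5,4,-5],[(0,-2,0)]), ([5],[(0,-3,0)])],
    [([1],[(0,-1,0)]), ([3],[(0,-3,0)])],
    [([1,6,-4,-6],[(0,-1,0)],[(0,-3,0)]), ([2,6,5,-4,-5,-6],[(0,-3,0)],[(0,-1,0)]),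
     ([3,6,-5,-6],[(0,-3,0)],[(0,-1,0)])]),
  ([(2,1,True),(2,2,False)], [(1,3,True),(3,2,True),(3,3,False)], [([6],[1,6,5],False)], [6],
    [([-4],[(0,-3,0)]), ([],[(0,-1,0)])],
    [([1],[(0,-4,0)]), ([-1],[(0,3,1)]), ([],[(1,2,0)])],
    [([2],[(0,-1,0)],[(0,-1,0)]), ([5],[(0,-2,0)],[(0,-2,0)]), ([1,6,4,-6],[(4,-3,2),(0,-1,0),(2,-2,0)],[]),
     ([1,6,-3,-6],[(4,-4,2),(0,-1,0),(2,-2,0)],[(2,2,0),(2,2,0)])]),
  ([(2,1,True),(2,2,False),(1,1,False)], [(2,1,True),(2,2,False)], [], [],
    [([4],[(0,-3,0)]), ([],[(0,-1,0)]), ([4,4],[(0,-4,0)])],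
    [([1],[(0,-3,0)]), ([],[(0,2,0)])],
    [([2],[(0,-1,0)],[(0,-1,0)]), ([5],[(0,-2,0)],[(0,-2,0)]), ([1,-4],[(0,-1,0),(0,2,0)],[(0,-3,0)]),
     ([3,-4,-4],[(0,-3,0),(0,2,0)],[(1,2,0),(0,-3,0)])]),
  ([(2,1,True),(1,1,False)], [(2,1,True),(2,2,False),(1,1,False)], [([7],[-2,7,-3],False),
   ([6],[-2,6,4],False)], [6],
    [([-3],[(0,-2,0)]), ([5],[(0,-3,0)])],
    [([-1],[(0,2,1)]), ([],[(1,1,0)]), ([2],[(0,-3,0)])],
    [([4],[(0,-1,0)],[(0,-1,0)]), ([1,6,3,-6],[],[(3,-4,3),(2,-1,0)]),
     ([2,6,-5,-6],[(1,4,4),(0,-5,0)],[(1,4,0),(0,-5,1)]), ([1,7,3,-7,2],[(2,-2,2),(1,-1,0)],[(0,-5,0)]),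
     ([1,2,1],[(0,-5,2)],[(0,-5,1)])]),
  ([(3,1,True),(2,2,False),(1,1,False)], [(2,1,True),(1,1,False)], [], [],
    [([4],[(0,-1,0)]), ([],[(0,-2,0)]), ([5],[(0,-3,0)])],
    [([1],[(0,-1,0)]), ([3],[(0,-3,0)])],
    [([1,-4],[(0,-3,0)],[(0,-1,0)]), ([2],[(0,-2,0)],[(0,-2,0)]), ([3,-5],[(0,-1,0)],[(0,-1,0)])]),
  ([(3,1,True),(3,3,False),(1,1,False)], [(2,1,True),(1,1,False)], [], [],
    [([4],[(0,-2,0)]), ([-5,-5],[(0,-3,0)]), ([5],[(0,-4,0)])],
    [([1],[(0,-2,0)]), ([3],[(0,-4,0)])],
    [([4,4,5],[(0,-1,1)],[(0,-1,2)]), ([1,-4],[(0,-4,0)],[(0,-2,0)]),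
     ([2,5,5],[(1,-1,0),(0,-4,0)],[(1,-1,0),(0,-4,0)]), ([3,-5],[(0,-2,0)],[(0,-2,0)])]),
  ([(2,3,True),(3,1,True),(3,3,False)], [(2,1,True),(1,1,False)], [([6],[-2,6,5],False)], [6],
    [([4],[(0,-1,0)]), ([-4],[(0,-2,0)]), ([],[(0,-3,0)])],
    [([1],[(0,-1,0)]), ([2,2],[(0,-4,0)])],
    [([1,6,-4,-6],[],[(3,-4,2),(1,2,0),(0,-3,0)]), ([2,6,4,-6],[(1,4,1),(1,-2,0),(0,-3,0)],[(0,-5,0)]),
     ([3],[(0,-3,0)],[(0,-3,0)]),
     ([2,2,6,-5,-6],[(1,-1,0),(0,-3,0)],[(2,4,1),(5,-4,2),(3,2,0),(0,-5,0),(1,-3,0)]),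
     ([1,2],[(0,-5,1)],[(0,-3,0),(0,-3,0)])]),
  ([(3,1,True),(3,3,False),(3,1,False)], [(2,1,True),(2,1,False),(1,1,False)], [], [],
    [([4],[(0,-1,0)]), ([4,-6,4],[(0,-2,0)]), ([5],[(0,-3,0)])],
    [([1],[(0,-1,0)]), ([3],[(0,-3,0)]), ([1,-2,1],[(0,-4,0)])],
    [([1,-4],[(0,-3,0)],[(0,-1,0)]), ([2,-4,6,-4],[(0,-3,0)],[(0,-3,0)]), ([3,-5],[(0,-3,0)],[(0,-1,0)]),
     ([1,-2,1,-6],[(0,-1,0)],[(0,-1,0)])]),
  ([(3,1,True),(1,1,True),(3,1,False)], [(2,1,True),(2,1,False),(1,1,False)], [], [],
    [([4],[(0,-1,0)]), ([-5,4,6],[(0,-2,0)]), ([5],[(0,-3,0)])],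
    [([1],[(0,-1,0)]), ([3],[(0,-3,0)]), ([-1,3,2],[(0,-4,0)])],
    [([1,-4],[(0,-3,0)],[(0,-1,0)]), ([2,-6,-4,5],[(0,-1,0)],[(0,-1,0)]), ([3,-5],[(0,-3,0)],[(0,-1,0)]),
     ([-1,3,2,-6],[(0,-1,0)],[(0,-1,0)])]),
  ([(3,1,True),(3,3,True),(3,1,False)], [(2,1,True),(2,1,False),(1,1,False)], [], [],
    [([4],[(0,-1,0)]), ([4,-6,5],[(0,-2,0)]), ([5],[(0,-3,0)])],
    [([1],[(0,-1,0)]), ([3],[(0,-3,0)]), ([3,-2,1],[(0,-4,0)])],
    [([1,-4],[(0,-3,0)],[(0,-1,0)]), ([2,-5,6,-4],[(0,-3,0)],[(0,-3,0)]), ([3,-5],[(0,-3,0)],[(0,-1,0)]),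
     ([3,-2,1,-6],[(0,-1,0)],[(0,-1,0)])]),
  ([(3,1,True),(2,3,False),(3,1,False)], [(3,1,True),(3,2,False),(3,1,False)], [], [],
    [([4],[(0,-1,0)]), ([-4,5,4],[(0,-2,0)]), ([6],[(0,-3,0)])],
    [([1],[(0,-1,0)]), ([1,2,-1],[(0,-4,0)]), ([3],[(0,-3,0)])],
    [([1,-4],[(0,-3,0)],[(0,-1,0)]), ([2,-4,-5,4],[(0,-2,0)],[(0,-3,0)]), ([3,-6],[(0,-3,0)],[(0,-1,0)]),
     ([1,2,-1,-5],[(0,-3,0)],[(0,-4,0)])]),
  ([(3,1,True),(2,1,True),(3,1,False)], [(3,1,True),(3,2,False),(3,1,False)], [], [],
    [([4],[(0,-1,0)]), ([6,-4,5],[(0,-2,0)]), ([6],[(0,-3,0)])],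
    [([1],[(0,-1,0)]), ([1,-3,2],[(0,-4,0)]), ([3],[(0,-3,0)])],
    [([1,-4],[(0,-3,0)],[(0,-1,0)]), ([2,-5,4,-6],[(0,-2,0)],[(0,-1,0)]), ([3,-6],[(0,-3,0)],[(0,-1,0)]),
     ([1,-3,2,-5],[(0,-3,0)],[(0,-4,0)])]),
  ([(1,3,True),(2,1,True),(3,1,False)], [(3,1,True),(3,2,False),(3,1,False)], [], [],
    [([-4],[(0,-1,0)]), ([-6,-4,5],[(0,-2,0)]), ([-6],[(0,-3,0)])],
    [([-1],[(0,1,1)]), ([-1,-3,2],[(0,-4,0)]), ([-3],[(0,3,1)])],
    [([1,4],[(0,-1,0)],[(0,-3,0)]), ([2,-5,4,6],[(0,-2,0)],[(0,-1,0)]), ([3,6],[(0,-3,0)],[(0,-1,0)]),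
     ([-1,-3,2,-5],[(0,3,1)],[(0,-4,0)])]),
  ([(2,1,True),(2,2,False),(2,1,False)], [(3,1,True),(1,1,True),(3,3,False)], [], [],
    [([4],[(0,-3,0)]), ([],[(0,-1,0)]), ([-4,5],[(0,-4,0)])],
    [([1],[(0,-3,0)]), ([1,3],[(0,-5,0)]), ([],[(0,2,0)])],
    [([2],[(0,-1,0)],[(0,-1,0)]), ([6],[(0,-2,0)],[(0,-2,0)]), ([1,-4],[(0,-1,0),(0,2,0)],[(0,-3,0)]),
     ([3,-5,4],[(0,-1,0)],[(0,-3,0),(0,-2,0)]), ([1,3,-5],[(1,-3,0),(0,-1,0)],[(1,-1,0),(0,-3,0)])]),
  ([(3,3,True),(3,2,True),(3,3,False)], [(2,1,True),(2,2,False),(2,1,False)], [], [],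
    [([-6,4],[(0,-3,0)]), ([4],[(0,-4,0)]), ([],[(0,-1,0)])],
    [([2],[(0,-4,0)]), ([],[(0,2,0)]), ([2,-1],[(0,-5,0)])],
    [([3],[(0,-1,0)],[(0,-1,0)]), ([5],[(0,-2,0)],[(0,-2,0)]), ([1,-4,6],[(0,-1,0)],[(0,-1,0)]),
     ([2,-4],[(0,-1,0),(0,2,0)],[(0,-4,0)]), ([2,-1,-6],[(0,2,0)],[(1,1,0),(0,-4,0)])]),
  ([(3,1,True),(2,1,True),(3,3,False)], [(2,1,True),(2,2,False),(3,1,False)], [], [],
    [([4],[(0,-3,0)]), ([6,-4],[(0,-4,0)]), ([],[(0,-1,0)])],
    [([1],[(0,-3,0)]), ([],[(0,2,0)]), ([2,1],[(0,-5,0)])],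
    [([3],[(0,-1,0)],[(0,-1,0)]), ([5],[(0,-2,0)],[(0,-2,0)]), ([1,-4],[(0,-1,0),(0,2,0)],[(0,-3,0)]),
     ([2,4,-6],[(0,-4,0)],[(1,-2,0),(0,-3,0)]), ([2,1,-6],[(0,-5,0)],[(1,-1,0),(0,-3,0)])]),
  ([(1,3,True),(2,1,True),(3,3,False)], [(2,1,True),(2,2,False),(3,1,False)], [], [],
    [([-4],[(0,-3,0)]), ([-6,-4],[(0,-4,0)]), ([],[(0,-1,0)])],
    [([-1],[(0,3,1)]), ([],[(0,2,0)]), ([1,-2],[(0,-5,0)])],
    [([3],[(0,-1,0)],[(0,-1,0)]), ([5],[(0,-2,0)],[(0,-2,0)]), ([1,4],[(0,-3,0)],[(0,-1,0),(0,-2,0)]),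
     ([2,4,6],[(0,-4,0)],[(0,-3,0),(1,-2,0)]), ([1,-2,-6],[(0,-5,0)],[(1,3,1),(0,-1,0)])]),
  ([(1,1,True),(2,2,False),(2,1,False)], [(3,3,True),(2,2,False),(2,1,False)], [([7,-6],[-1,7],False)], [7],
    [([4],[(0,-1,0)]), ([],[(0,-2,0)]), ([6],[(0,-3,0)])],
    [([1],[(0,-1,0)]), ([],[(1,-4,0)]), ([3],[(0,-3,0)])],
    [([1,7,-4,-7],[],[(1,-3,3),(2,-3,3),(0,-5,0)]), ([2],[(0,-2,0)],[(0,-2,0)]),
     ([3,7,-6,-7],[(1,-3,3),(4,3,3),(0,-2,0),(2,-4,0)],[(0,-1,3)]), ([-5],[(0,-4,0)],[(0,-4,0)]),
     ([1,-3,-3,1],[],[(0,-6,0),(1,2,0),(1,2,0)]), ([1,1],[(0,-6,0)],[(0,-6,0)])]),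
  ([(2,2,True),(2,2,False),(2,1,False)], [(1,1,True),(2,2,False),(2,1,False)], [([7],[-2,7,4],False)], [7],
    [([4],[(0,-4,0)]), ([],[(0,-1,0)]), ([-6],[(0,-5,0)])],
    [([1],[(0,-4,0)]), ([],[(1,3,0)]), ([-3],[(0,5,1)])],
    [([2],[(0,-1,0)],[(0,-1,0)]), ([1,1],[(0,-1,0),(0,-1,0)],[(0,-1,0),(0,-1,0)]),
     ([5],[(0,-3,0)],[(0,-3,0)]), ([1,7,-4,-7],[],[(1,-4,3),(2,-4,3),(1,2,0),(0,-1,0),(0,-1,0)]),
     ([3,7,6,-7],[(0,-1,0),(1,-3,0)],[(2,4,0),(0,-2,0),(1,1,0),(0,-1,0)])]),
  ([(3,3,True),(3,1,True),(3,3,False)], [(2,2,True),(2,2,False),(2,1,False)], [], [],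
    [([4],[(0,-1,0)]), ([6,4],[(0,-2,0)]), ([],[(0,-3,0)])],
    [([1],[(0,-1,0)]), ([],[(0,-4,0)]), ([2,1],[(0,-5,0)])],
    [([1,-4],[(0,-3,0),(0,-4,0)],[(0,-3,0),(0,-4,0)]),
     ([2,-4,-6],[(0,-3,0),(0,-4,0),(0,-4,0)],[(1,-4,0),(0,-1,0)]), ([3],[(0,-3,0)],[(0,-3,0)]),
     ([-5],[(0,-4,0)],[(0,-4,0)]), ([2,1,-6],[(0,-3,0),(0,-3,0),(0,-4,0)],[(1,-3,0),(0,-1,0)])]),
  ([(1,1,True),(3,1,True),(3,3,False)], [(3,3,True),(3,1,True),(3,3,False)], [([7],[-1,7,6],False)], [7],
    [([4],[(0,-4,0)]), ([-5],[(0,-5,0)]), ([],[(0,-1,0)])],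
    [([1],[(0,-4,0)]), ([-2],[(0,5,1)]), ([],[(1,3,0)])],
    [([3],[(0,-1,0)],[(0,-1,0)]), ([1,1],[(0,-2,0)],[(0,-2,0)]), ([6],[(0,-3,0)],[(0,-3,0)]),
     ([1,7,-4,-7],[],[(0,-2,0),(2,3,0),(2,3,0)]), ([2,7,5,-7],[(4,4,3),(0,-1,0),(2,-3,0)],[(0,-2,0)])]),
  ([(1,1,True),(3,2,True),(3,1,False)], [(1,1,True),(2,3,False),(3,1,False)], [], [],
    [([4],[(0,-1,0)]), ([4,-6,-5],[(0,-2,0)]), ([6],[(0,-3,0)])],
    [([1],[(0,-1,0)]), ([3,-1,2],[(0,-4,0)]), ([3],[(0,-3,0)])],
    [([1,-4],[(0,-1,0)],[(0,-1,0)]), ([2,5,6,-4],[(0,-5,0),(0,3,1)],[(0,-2,0)]),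
     ([3,-6],[(0,-3,0)],[(0,-1,0)]), ([3,-1,2,-5],[(0,-4,0)],[(0,-3,0)]), ([3,3],[(0,-5,0)],[(0,-6,0)]),
     ([1,1],[(0,-6,0)],[(0,-6,0)])]),
  ([(1,1,True),(3,2,False),(3,1,False)], [(1,1,True),(3,2,True),(3,1,False)], [], [],
    [([4],[(0,-3,0)]), ([5,6,4],[(0,-4,0)]), ([6],[(0,-5,0)])],
    [([1],[(0,-3,0)]), ([2,1,3],[(0,-6,0)]), ([3],[(0,-5,0)])],
    [([1,1],[(0,-1,0)],[(0,-1,0)]), ([4,4],[(0,-2,0)],[(0,-2,0)]), ([1,-4],[(0,-3,0)],[(0,-3,0)]),
     ([2,-4,-6,-5],[(1,2,0),(0,-5,0)],[(0,-4,0)]), ([3,-6],[(0,-5,0)],[(0,-3,0)]),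
     ([2,1,3,-5],[(1,-1,0),(0,-5,0)],[(0,-6,0)])]),
  ([(3,3,True),(3,1,True),(3,1,False)], [(2,2,True),(2,1,False),(1,1,False)], [], [],
    [([4],[(0,-5,0)]), ([4,-5,-6],[(0,-6,0)]), ([5],[(0,-7,0)])],
    [([1],[(0,-5,0)]), ([3],[(0,-7,0)]), ([3,-1,2],[(0,-8,0)])],
    [([1,1],[(0,-2,0)],[(0,-2,0)]), ([3,3],[(0,-2,0)],[(0,-1,0)]), ([4,4],[(0,-4,0)],[(0,-4,0)]),
     ([5,5],[(0,-4,0)],[(0,-3,0)]), ([1,-4],[(0,-7,0)],[(0,-7,0)]),
     ([2,6,5,-4],[(1,-3,0),(0,-7,0)],[(0,-1,0),(0,5,1)]), ([3,-5],[(0,-7,0)],[(0,-5,0)]),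
     ([3,-1,2,-6],[(0,-5,0)],[(0,-5,0)])]),
  ([(3,3,True),(3,3,False),(3,1,False)], [(3,3,True),(3,1,True),(3,1,False)], [], [],
    [([4],[(0,-3,0)]), ([4,-5,6],[(0,-4,0)]), ([6],[(0,-5,0)])],
    [([1],[(0,-3,0)]), ([-3,-2,1],[(0,-6,0)]), ([3],[(0,-5,0)])],
    [([4,4],[(0,-2,0)],[(0,-2,0)]), ([6,6],[(0,-2,0)],[(0,-1,0)]), ([1,-4],[(0,-5,0)],[(0,-5,0)]),
     ([2,-6,5,-4],[(0,-5,0)],[(0,-5,0)]), ([3,-6],[(0,-5,0)],[(0,-3,0)]),
     ([-3,-2,1,-5],[(0,5,1),(0,2,0)],[(0,3,1),(0,1,0)])]),
  ([(1,1,True),(3,1,True),(3,1,False)], [(3,3,True),(3,1,True),(3,1,False)], [([7,-6],[-1,7],False)], [7],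
    [([4],[(0,-1,0)]), ([-5],[(0,-2,0)]), ([6],[(0,-3,0)])],
    [([1],[(0,-1,0)]), ([-2],[(0,2,1)]), ([3],[(0,-3,0)])],
    [([1,7,-4,-7],[],[(1,-3,3),(2,-3,3),(0,-4,0)]),
     ([2,7,5,-7],[(1,1,1),(1,3,0),(0,4,3),(0,-5,0)],[(0,-5,0)]), ([3,7,-6,-7],[(0,-3,0)],[(0,-1,3)]),
     ([1,-3,-3,1],[],[(0,-4,0)]), ([1,1],[(0,-5,0)],[(0,-5,0)])]),
  ([(1,1,True),(2,1,False),(1,1,False)], [(1,1,True),(3,1,True),(3,1,False)], [], [],
    [([4],[(0,-3,0)]), ([6],[(0,-4,0)]), ([4,-5,6],[(0,-5,0)])],
    [([1],[(0,-3,0)]), ([-2,-3,1],[(0,-6,0)]), ([2],[(0,-4,0)])],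
    [([4,4],[(0,-1,0)],[(0,-1,0)]), ([6,6],[(0,-2,0)],[(0,-1,0)]), ([1,-4],[(0,-3,0)],[(0,-3,0)]),
     ([2,-6],[(0,-4,0)],[(0,-3,0)]), ([3,-6,5,-4],[(0,-3,0)],[(0,-3,0)]),
     ([-2,-3,1,-5],[(0,4,1),(0,2,0)],[(0,3,1),(0,1,0)])]),
  ([(1,1,True),(3,3,False),(3,1,False)], [(1,1,True),(3,1,True),(3,1,False)], [], [],
    [([4],[(0,-1,0)]), ([6,-4,5],[(0,-2,0)]), ([6],[(0,-3,0)])],
    [([1],[(0,-1,0)]), ([1,-3,-2],[(0,-4,0)]), ([3],[(0,-3,0)])],
    [([1,-4],[(0,-1,0)],[(0,-1,0)]), ([2,-5,4,-6],[(0,-3,0)],[(0,-3,0)]), ([3,-6],[(0,-3,0)],[(0,-1,0)]),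
     ([1,-3,-2,-5],[(0,3,1),(0,-5,0)],[(1,3,1),(2,3,1),(1,-5,0),(0,-1,0)]), ([-6,-6],[(0,-5,0)],[(0,-6,0)]),
     ([-4,-4],[(0,-6,0)],[(0,-6,0)])]),
  ([(3,3,True),(2,1,False),(1,1,False)], [(1,1,True),(2,1,False),(1,1,False)], [([7],[-3,7,4],False)], [7],
    [([4],[(0,-1,0)]), ([5],[(0,-2,0)]), ([6],[(0,-3,0)])],
    [([1],[(0,-1,0)]), ([2],[(0,-2,0)]), ([3],[(0,-3,0)])],
    [([1,7,-4,-7],[],[(1,-1,3),(2,-1,3),(0,-4,0)]), ([2,7,-5,-7],[(0,-2,0)],[(2,-1,3),(0,5,1)]),
     ([3,7,-6,-7],[(0,-1,0)],[(2,-1,3),(0,5,1)]), ([3,-1,-1,3],[(0,4,2)],[(0,4,2)]),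
     ([-1,-3,1,3],[(0,5,0)],[(0,5,0)])]),
  ([(3,3,True),(3,2,True),(1,1,False)], [(3,3,True),(2,1,False),(1,1,False)], [], [],
    [([4],[(0,-4,0)]), ([4,-6,-5],[(0,-5,0)]), ([6],[(0,-6,0)])],
    [([1],[(0,-4,0)]), ([-2,1,3],[(0,-7,0)]), ([3],[(0,-6,0)])],
    [([1,3,1,3],[(0,-1,1)],[(0,-1,1)]), ([4,4],[(0,-3,0)],[(0,-3,0)]), ([6,6],[(0,-2,0)],[(0,-2,0)]),
     ([1,-4],[(0,-6,0)],[(0,-6,0)]), ([2,5,6,-4],[(1,-2,0),(0,-6,0)],[(0,7,1),(0,-1,0),(0,7,3),(0,5,2)]),
     ([3,-6],[(0,-4,0)],[(0,-4,0)]), ([-2,1,3,-5],[(1,-1,1),(1,4,1),(2,6,1),(4,5,1),(1,2,0)],[(0,-4,0)])]),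
  ([(1,1,True),(3,3,False),(1,1,False)], [(2,2,True),(3,3,False),(1,1,False)], [([7],[-1,7,5],False)], [7],
    [([4],[(0,-1,0)]), ([5],[(0,-2,0)]), ([6],[(0,-3,0)])],
    [([1],[(0,-1,0)]), ([2],[(0,-2,0)]), ([3],[(0,-3,0)])],
    [([1,7,-4,-7],[],[(1,-2,3),(2,-2,3),(0,-4,0)]),
     ([2,7,-5,-7],[(0,-3,0)],[(0,7,2),(2,2,0),(3,-3,3),(4,-2,3),(2,-5,4),(0,-7,2)]),
     ([3,7,-6,-7],[(0,-1,0)],[(0,2,0),(1,-1,3),(2,-2,3),(0,6,1)]), ([1,-2,-2,1],[(0,-7,0)],[(0,-7,0)]),
     ([3,-1,2,-3,-2,1],[(0,8,1)],[(0,8,1)]), ([-2,-1,2,1],[(0,-8,0)],[(0,-8,0)]), ([1,-3,-3,1],[],[]),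
     ([-3,-1,3,1],[],[])]),
  ([(3,3,True),(3,3,False),(1,1,False)], [(1,1,True),(3,3,False),(1,1,False)], [([7],[-3,7,4],False)], [7],
    [([4],[(0,-1,0)]), ([5],[(0,-2,0)]), ([6],[(0,-3,0)])],
    [([1],[(0,-1,0)]), ([2],[(0,-2,0)]), ([3],[(0,-3,0)])],
    [([1,7,-4,-7],[],[(1,-1,3),(2,-1,3),(0,-4,0)]),
     ([2,7,-5,-7],[(0,-3,0)],[(0,1,0),(1,-3,3),(2,-1,3),(0,5,1)]),
     ([3,7,-6,-7],[(0,-1,0)],[(2,-1,3),(0,5,1)]), ([3,-1,-1,3],[(0,4,2)],[(0,4,2)]),
     ([-1,-3,1,3],[(0,5,0)],[(0,5,0)])]),
  ([(1,1,True),(3,3,True),(1,1,False)], [(1,1,True),(3,3,False),(1,1,False)], [], [],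
    [([4],[(0,-3,0)]), ([5,6,4],[(0,-4,0)]), ([6],[(0,-5,0)])],
    [([1],[(0,-3,0)]), ([3,1,2],[(0,-6,0)]), ([3],[(0,-5,0)])],
    [([1,1],[(0,-1,0)],[(0,-1,0)]), ([4,4],[(0,-2,0)],[(0,-2,0)]), ([1,-4],[(0,-3,0)],[(0,-3,0)]),
     ([2,-4,-6,-5],[(1,2,0),(0,-5,0)],[(1,2,0),(0,-5,0)]), ([3,-6],[(0,-3,0)],[(0,-3,0)]),
     ([3,1,2,-5],[(0,-1,0),(0,-5,0)],[(0,-1,0),(0,-5,0)])]),
  ([(3,3,True),(1,1,True),(1,1,False)], [(1,1,True),(3,3,True),(1,1,False)], [([7],[-3,7,4],False)], [7],
    [([4],[(0,-1,0)]), ([5],[(0,-2,0)]), ([6],[(0,-3,0)])],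
    [([1],[(0,-1,0)]), ([2],[(0,-2,0)]), ([3],[(0,-3,0)])],
    [([1,7,-4,-7],[],[(1,-1,3),(2,-1,3),(0,-4,0)]),
     ([2,7,-5,-7],[(0,4,2),(2,1,0),(0,5,3),(0,-3,0)],[(1,-3,3),(2,-1,3),(0,5,1)]),
     ([3,7,-6,-7],[(0,-1,0)],[(2,-1,3),(0,5,1)]), ([3,-1,-1,3],[(0,4,2)],[(0,4,2)]),
     ([-1,-3,1,3],[(0,5,0)],[(0,5,0)])]),
  ([(2,3,True),(2,1,True),(3,3,False)], [(3,1,True),(2,2,False),(2,1,False)], [([7],[-2,7,6],False)], [7],
    [([4],[(0,-3,0)]), ([6,4],[(0,-4,0)]), ([],[(0,-1,0)])],
    [([1],[(0,-3,0)]), ([],[(1,2,0)]), ([2,-1],[(0,-5,0)])],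
    [([3],[(0,-1,0)],[(0,-1,0)]), ([5],[(0,-2,0)],[(0,-2,0)]), ([1,7,-4,-7],[],[(1,-4,4),(0,-1,0)]),
     ([2,7,-4,-6,-7],[(1,2,0)],[(3,-4,3),(0,-3,0)]), ([2,-1,7,-6,-7],[(1,2,0)],[(5,-4,3),(2,5,1),(1,1,0)])]),
  ([(3,3,True),(3,1,False),(1,1,False)], [(1,1,True),(3,1,False),(1,1,False)], [([7],[-3,7,4],False)], [7],
    [([4],[(0,-1,0)]), ([5],[(0,-2,0)]), ([6],[(0,-3,0)])],
    [([1],[(0,-1,0)]), ([2],[(0,-2,0)]), ([3],[(0,-3,0)])],
    [([1,7,-4,-7],[],[(1,-1,3),(2,-1,3),(0,-4,0)]), ([2,7,-5,-7],[(0,-3,0)],[(2,-1,3),(0,5,1)]),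
     ([3,7,-6,-7],[(0,-1,0)],[(2,-1,3),(0,5,1)]), ([3,-1,-1,3],[(0,4,2)],[(0,4,2)]),
     ([-1,-3,1,3],[(0,5,0)],[(0,5,0)])]),
  ([(1,1,True),(3,1,True),(1,1,False)], [(1,1,True),(3,1,False),(1,1,False)], [], [],
    [([4],[(0,-1,0)]), ([5,6,4],[(0,-2,0)]), ([6],[(0,-3,0)])],
    [([1],[(0,-1,0)]), ([1,-2,3],[(0,-4,0)]), ([3],[(0,-3,0)])],
    [([1,-4],[(0,-1,0)],[(0,-1,0)]), ([2,-4,-6,-5],[(1,-5,0),(0,-3,0)],[(0,-1,0),(0,-5,0)]),
     ([3,-6],[(0,-1,0)],[(0,-1,0)]), ([1,-2,3,-5],[(1,3,1),(0,-6,0)],[(0,-1,0)]),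
     ([-4,-4],[(0,-5,0)],[(0,-5,0)]), ([1,-6,1,-6],[(0,-1,0),(0,-1,0)],[(0,-1,0),(0,-1,0)])]),
  ([(3,3,True),(3,1,True),(1,1,False)], [(3,3,True),(3,1,False),(1,1,False)], [], [],
    [([4],[(0,-5,0)]), ([4,5,6],[(0,-6,0)]), ([6],[(0,-7,0)])],
    [([1],[(0,-5,0)]), ([1,2,3],[(0,-8,0)]), ([3],[(0,-7,0)])],
    [([1,1],[(0,-2,0)],[(0,-2,0)]), ([3,3],[(0,-1,0)],[(0,-1,0)]), ([4,4],[(0,-4,0)],[(0,-4,0)]),
     ([6,6],[(0,-3,0)],[(0,-3,0)]), ([1,-4],[(0,-7,0)],[(0,-7,0)]),
     ([2,-6,-5,-4],[(1,3,0),(0,-7,0)],[(0,-5,0),(0,4,0)]), ([3,-6],[(0,-5,0)],[(0,-5,0)]),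
     ([1,2,3,-5],[(1,-1,0),(0,-7,0)],[(0,-2,0),(0,-5,0)])]),
  ([(3,1,True),(2,1,False),(1,1,False)], [(3,1,True),(2,1,True),(1,1,False)], [], [],
    [([4],[(0,-1,0)]), ([-4,-5],[(0,-2,0)]), ([-4,-4],[(0,-3,0)])],
    [([1],[(0,-1,0)]), ([-2,-1],[(0,-4,0)]), ([-1,-1],[(0,-5,0)])],
    [([1,-4],[(0,-6,0)],[(0,-1,0)]), ([2,5,4],[(0,-2,0)],[(1,1,0),(0,5,2)]),
     ([3,4,4],[(0,5,1),(0,1,1)],[(1,1,0),(0,5,2)]), ([-2,-1,-5],[(0,-4,0)],[(1,3,1),(0,1,1)]),
     ([-1,-1,-6],[(1,3,1),(0,1,1)],[(0,6,1),(0,-5,1),(0,-1,0)]), ([3,-6],[(0,-1,0)],[(0,-1,0)])]),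
  ([(3,1,True),(3,3,True),(1,1,False)], [(3,1,True),(1,1,True),(1,1,False)], [], [],
    [([4],[(0,-1,0)]), ([-5,-6],[(0,-2,0)]), ([-4,-4],[(0,-3,0)])],
    [([1],[(0,-1,0)]), ([1,1,-2],[(0,-4,0)]), ([-1,-1],[(0,-5,0)])],
    [([1,-4],[(0,-6,0)],[(0,-1,0)]), ([2,6,5],[(0,-3,0)],[(0,-3,0)]),
     ([3,4,4],[(0,5,1),(0,1,1)],[(1,1,0),(0,5,2)]),
     ([1,1,-2,-5],[(2,3,1),(2,1,0),(1,5,2),(0,-6,0)],[(0,-1,0)]),
     ([-1,-1,-6],[(1,3,1),(0,1,1)],[(0,6,1),(0,-5,1),(0,-1,0)]), ([3,-6],[(0,-1,0)],[(0,-1,0)])]),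
  ([(3,1,True),(3,1,False),(1,1,False)], [(3,1,True),(1,1,True),(1,1,False)], [], [],
    [([4],[(0,-1,0)]), ([-4,-5],[(0,-2,0)]), ([-4,-4],[(0,-3,0)])],
    [([1],[(0,-1,0)]), ([-2,-1],[(0,-4,0)]), ([-1,-1],[(0,-5,0)])],
    [([1,-4],[(0,-6,0)],[(0,-1,0)]), ([2,5,4],[(0,-3,0)],[(1,1,0),(0,5,2)]),
     ([3,4,4],[(0,5,1),(0,1,1)],[(1,1,0),(0,5,2)]),
     ([-2,-1,-5],[(0,6,1),(0,-5,1),(0,-1,0)],[(1,3,1),(0,1,1)]),
     ([-1,-1,-6],[(1,3,1),(0,1,1)],[(0,6,1),(0,-5,1),(0,-1,0)]), ([3,-6],[(0,-1,0)],[(0,-1,0)])]),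
  ([(3,3,True),(3,2,True),(3,1,False)], [(1,1,True),(3,1,True),(2,1,False)], [([3,7],[7,-4],False)], [7],
    [([4],[(0,-3,0)]), ([-5],[(0,-4,0)]), ([6,4,-5],[(0,-5,0)])],
    [([1],[(0,-3,0)]), ([-2],[(0,4,1)]), ([3,-2,1],[(0,-6,0)])],
    [([1,1],[(0,-2,0)],[(0,-2,0)]), ([3,3],[(0,-2,0)],[(0,-1,0)]),
     ([1,7,-4,-7],[(1,-3,3),(2,-3,3),(1,1,0)],[(0,-2,0)]), ([2,7,5,-7],[],[(2,5,0),(3,-4,3),(1,-2,0)]),
     ([3,7,5,-4,-6,-7],[(0,-2,0),(3,4,3),(2,-3,2),(0,6,0)],[(0,-3,0)]),
     ([3,-2,1,7,-6,-7],[(4,4,0),(2,-2,0)],[(0,-3,0)])]),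
  ([(3,3,True),(3,2,False),(1,1,False)], [(3,3,True),(2,1,True),(1,1,False)], [], [],
    [([4],[(0,-1,0)]), ([-5,4,6],[(0,-2,0)]), ([6],[(0,-3,0)])],
    [([1],[(0,-1,0)]), ([1,-3,-2],[(0,-4,0)]), ([3],[(0,-3,0)])],
    [([1,-4],[(0,-3,0)],[(0,-3,0)]), ([2,-6,-4,5],[(0,-5,0),(0,1,1)],[(3,-5,1),(2,3,0),(0,-2,0),(1,1,0)]),
     ([3,-6],[(0,-1,0)],[(0,-1,0)]),
     ([1,-3,-2,-5],[(0,4,2),(0,2,1),(2,2,1),(0,-6,0)],[(0,4,2),(0,2,1),(2,3,1),(0,-6,0)]),
     ([3,-4,-6,1],[(0,-7,0)],[(0,-7,0)]), ([-6,-4,-6,-4],[(0,-6,1)],[(0,-6,1)]),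
     ([1,-6,-4,3],[(0,-5,0)],[(0,-5,0)])]),
  ([(1,1,True),(3,2,False),(1,1,False)], [(3,3,True),(2,1,True),(1,1,False)], [([7],[-1,7,6],False)], [7],
    [([4],[(0,-4,0)]), ([6,-5,4],[(0,-5,0)]), ([6],[(0,-6,0)])],
    [([1],[(0,-4,0)]), ([1,-2,-3],[(0,-7,0)]), ([3],[(0,-6,0)])],
    [([1,1],[(0,-1,0)],[(0,-1,0)]), ([3,3],[(0,-1,0)],[(0,-1,0)]),
     ([1,3,1,3],[(0,-1,0),(0,-1,0)],[(0,-1,0),(0,-1,0)]),
     ([1,7,-4,-7],[],[(1,-6,3),(2,-6,3),(1,2,0),(0,-1,0)]),
     ([2,7,-4,5,-6,-7],[(0,-6,0)],[(0,7,2),(1,-4,3),(2,-6,3),(0,3,0),(0,-1,0)]),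
     ([3,7,-6,-7],[(0,-4,0)],[(0,6,0),(1,-4,3),(2,-6,3),(0,-2,0),(0,3,0),(0,-1,0)]),
     ([1,-2,-3,7,-5,-7],[(4,5,0),(5,-4,3),(2,1,0)],[(3,-4,3),(4,-6,3),(2,1,0),(1,2,0),(0,-1,0)])]),
  ([(2,1,True),(1,2,False),(3,1,False)], [(1,3,True),(3,2,True),(3,1,False)], [], [-6],
    [([4],[(0,-1,0)]), ([4,4,-6],[(0,-2,0)]), ([4,5,-6],[(0,-3,0)])],
    [([1],[(0,-1,0)]), ([-1,3,-1,2,1],[(0,-4,0)]), ([-1,2,1],[(0,-4,6),(1,-1,0),(0,3,1)])],
    [([1,-6,-4,6],[(0,-2,0)],[(0,-1,0),(0,-6,0)]), ([2,-4,-4,6],[(0,-1,0)],[(0,-2,0),(0,-6,0)]),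
     ([3,-5,-4,6],[(0,-3,0)],[(0,-1,0),(0,-6,0)]),
     ([-1,3,-1,2,1,-6,-5,6],[(2,-2,0),(1,-1,0),(0,2,1)],[(1,-4,7),(1,-1,0),(0,2,1)]),
     ([-1,2,1,-6],[(0,-4,6),(1,-1,0),(0,3,1)],[(2,-2,0),(1,-1,0),(0,2,1)]), ([-6,4,-6,4],[],[])]),
  ([(3,3,True),(2,3,False),(2,1,False)], [(1,1,True),(2,3,False),(2,1,False)], [([7,-5],[-1,-3,7,4],False)], [7],
    [([6,-4,-6],[(0,-5,0)]), ([5],[(0,-6,0)]), ([6],[(0,-7,0)])],
    [([3,1,3],[(0,-8,0)]), ([2],[(0,-6,0)]), ([3],[(0,-7,0)])],
    [([1,1],[(0,-3,0)],[(0,-3,0)]), ([2,2],[(0,-2,0)],[(0,-3,0)]), ([3,3],[(0,-2,0)],[(0,-1,0)]),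
     ([4,4],[(0,-4,0)],[(0,-4,0)]), ([1,7,6,4,-6,-7],[(1,8,2),(0,-3,0),(1,-4,0)],[(0,-8,4)]),
     ([2,7,-5,-7],[(0,-6,0)],[(1,8,2),(4,-8,2),(1,-7,0)]), ([3,7,-6,-7],[(0,-6,0)],[(1,-8,3),(0,3,0)]),
     ([3,1,3,7,-4,-7],[(1,6,0),(0,-2,0)],[(6,-8,2),(2,-6,0),(0,-8,5),(0,3,0)])]),
  ([(3,2,True),(1,2,False),(3,1,False)], [(3,2,True),(1,3,False),(2,1,False)], [([8],[2,8,6],False),
   ([7],[1,7,6],False)], [7],
    [([-4],[(0,-3,0)]), ([-4,-4,5],[(0,-4,0)]), ([-4,-5,4],[(0,-5,0)])],
    [([-1],[(0,3,1)]), ([-1,-1,2],[(0,-6,0)]), ([-1,-2,1],[(0,-7,0)])],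
    [([1,-2,1,-3],[],[(0,1,2)]), ([4,-5,4,-6],[],[(0,2,2)]), ([1,7,4,-7],[(0,-8,0)],[]),
     ([2,7,-5,4,4,-7],[(3,-8,3),(0,-9,0)],[(1,-10,0)]),
     ([3,7,-4,5,4,-7],[(3,-8,3),(1,10,0)],[(1,9,5),(0,-1,2)]),
     ([-1,-1,2,7,-5,-7],[(0,-9,2)],[(6,8,1),(1,-10,0)]),
     ([-1,-2,1,7,-6,-7],[(0,10,1)],[(1,9,1),(2,2,1),(0,8,1)]),
     ([3,2,8,6,5,-8],[(1,6,1),(0,1,0),(0,-3,0)],[(1,7,2),(1,-3,0)]),
     ([1,8,-4,-8,-2,-3],[],[(3,-7,2),(0,-6,4)]), ([2,8,5,-8],[(0,-3,0)],[(0,7,2)])]),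
  ([(3,2,True),(2,1,True),(3,3,False)], [(3,2,True),(2,1,True),(1,1,False)], [([8],[-2,8,-4],False),
   ([7],[1,-3,7,-4],False)], [7],
    [([-4,-6],[(0,-1,0)]), ([-5],[(0,-2,0)]), ([],[(0,-3,0)])],
    [([2,2,1],[(0,-4,0)]), ([-2],[(0,2,1)]), ([-1,-1,-2,-2],[(0,-5,0)])],
    [([1,7,6,4,-7],[(1,-6,0),(0,-3,0)],[(0,-7,0)]), ([2,7,5,-7],[],[(3,-8,3),(1,-6,3)]),
     ([3],[(0,-3,0)],[(0,-3,0)]), ([2,2,1,7,-4,-7],[(3,7,0),(3,-8,5),(2,-3,0)],[(2,6,1),(0,-8,0)]),
     ([-1,-1,-2,-2,7,-6,-7],[(2,8,1),(1,3,0)],[(2,8,2),(0,3,0)]),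
     ([-2,8,5,-8],[(0,3,0)],[(1,-2,3),(0,4,2),(1,-3,0)]),
     ([2,8,4,6,4,-8,2],[(7,-1,3),(6,4,5),(5,-2,2),(3,-4,3),(2,3,0),(0,-3,0)],[(0,-1,0),(0,-2,3)]),
     ([1,2,8,4,-8,2],[(1,-1,0),(0,-3,0),(0,-3,0)],[(6,-2,2),(4,-4,3),(3,3,0)])])]"

fun all_valid :: "certificate list \<Rightarrow> bool" where
  "all_valid [] = True"
| "all_valid ((A, B, D, d, ws, vs, rs) # cs) =
     (if valid_certificate A B D d ws vs rs then all_valid cs else False)"

fun merges :: "certificate list \<Rightarrow> (code \<times> code) list" where
  "merges [] = []"
| "merges ((A, B, _) # cs) = (A, B) # merges cs"

lemma merges_iso: "all_valid cs \<Longrightarrow> (A, B) \<in> set (merges cs) \<Longrightarrow> code_group A \<cong> code_group B"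
  by (induction cs rule: all_valid.induct) (auto split: if_splits intro: certificate_iso)

lemma all_certificates_valid: "all_valid certificates"
  by code_simp

text \<open>
  Each merged code is linked to a representative or to a code merged earlier, so all of them are
  linked to representatives.
\<close>
fun grounded :: "code list \<Rightarrow> (code \<times> code) list \<Rightarrow> bool" where
  "grounded S [] = True"
| "grounded S ((A, B) # ps) = (if member S B then grounded (A # S) ps else False)"

lemma grounded_iso:
  assumes "grounded S ps" "\<forall>(A, B)\<in>set ps. code_group A \<cong> code_group B"
    and "\<forall>B\<in>set S. \<exists>C\<in>R. code_group B \<cong> code_group C"
    and "A \<in> set S \<union> fst ` set ps"
  shows "\<exists>C\<in>R. code_group A \<cong> code_group C"
  using assms
proof (induction S ps rule: grounded.induct)
  case (2 S A' B ps)
  have B: "B \<in> set S" "grounded (A' # S) ps" using 2(2) by (auto simp: member_iff split: if_splits)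
  then obtain C where "C \<in> R" "code_group B \<cong> code_group C" using 2(4) by blast
  moreover have "code_group A' \<cong> code_group B" using 2(3) by simp
  ultimately have "\<exists>C\<in>R. code_group A' \<cong> code_group C" using iso_trans by blast
  then show ?case using 2(1)[OF _ B(2)] 2(2-5) B by (auto simp: member_iff)
qed simp

lemma grounded_merges: "grounded representatives (merges certificates)"
  by code_simp

lemma merged_codes_merges: "map fst (merges certificates) = merged_codes"
  by code_simp

lemma representatives_cover_table:
  assumes "A \<in> set representatives \<union> set merged_codes"
  shows "\<exists>B\<in>set representatives. code_group A \<cong> code_group B"
proof (rule grounded_iso[OF grounded_merges])
  show "\<forall>(A, B)\<in>set (merges certificates). code_group A \<cong> code_group B"
    using merges_iso[OF all_certificates_valid] by blast
  show "\<forall>B\<in>set representatives. \<exists>C\<in>set representatives. code_group B \<cong> code_group C"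
    using iso_refl by blast
  show "A \<in> set representatives \<union> fst ` set (merges certificates)"
    using assms by (simp flip: merged_codes_merges)
qed

section \<open>Exhaustion of the irreducible codes\<close>

text \<open>
  Renamings of the states of codes with two and three states. One map for each way of identifying
  states suffices, because the quotients are reduced further.
\<close>
definition maps2 :: "(int list \<times> int list) list" where
  "maps2 = [([1,1],[1]),([1,2],[1,2]),([2,1],[1,2])]"
definition maps3 :: "(int list \<times> int list) list" where
  "maps3 = [([2,1,3],[1,2,3]),([1,3,2],[1,2,3]),([3,2,1],[1,2,3]),([2,3,1],[1,2,3]),([3,1,2],[1,2,3]),
    ([1,2,3],[1,2,3]),([1,1,2],[1,2]),([1,2,1],[1,2]),([1,2,2],[1,2]),([1,1,1],[1])]"

definition covered :: "(int list \<times> int list) list \<Rightarrow> code \<Rightarrow> bool" where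
  "covered fs A = (if member representatives A then True
     else if member merged_codes A then True else reduces fs A)"

text \<open>
  The entries of a code are chosen from the last state to the first.
\<close>
function covered_all :: "(int list \<times> int list) list \<Rightarrow> code list \<Rightarrow> code \<Rightarrow> bool" where
  "covered_all fs [] A = covered fs A"
| "covered_all fs ([] # Q) A = True"
| "covered_all fs ((q # qs) # Q) A =
     (if covered_all fs Q (q # A) then covered_all fs (qs # Q) A else False)"
  by pat_completeness auto
termination
  by (relation "measure (\<lambda>(fs, Q, A). sum_list (map (\<lambda>qs. Suc (length qs)) Q))") auto

lemma covered_all_Cons:
  "covered_all fs (qs # Q) A \<longleftrightarrow> (\<forall>q\<in>set qs. covered_all fs Q (q # A))"
  by (induction qs) auto

definition inactive :: code where
  "inactive = [(1,1,False), (1,2,False), (1,3,False), (2,1,False), (2,2,False), (2,3,False),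
     (3,1,False), (3,2,False), (3,3,False)]"
definition activated :: code where
  "activated = [(1,1,True), (1,2,True), (1,3,True), (2,1,True), (2,2,True), (2,3,True),
     (3,1,True), (3,2,True), (3,3,True)]"
definition inactive_sorted :: code where
  "inactive_sorted = [(1,1,False), (2,1,False), (2,2,False), (3,1,False), (3,2,False), (3,3,False)]"
definition activated_sorted :: code where
  "activated_sorted = [(1,1,True), (2,1,True), (2,2,True), (3,1,True), (3,2,True), (3,3,True)]"
definition two_states :: code where
  "two_states = [(1,1,False), (1,2,False), (2,1,False), (2,2,False),
     (1,1,True), (1,2,True), (2,1,True), (2,2,True)]"
definition one_state :: code where
  "one_state = [(1,1,False), (1,1,True)]"

lemma covered_one_active:
  "covered_all maps3 [inactive_sorted, inactive, activated_sorted] []"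
  by code_simp

lemma covered_two_active:
  "covered_all maps3 [inactive_sorted, activated_sorted, activated] []"
  by code_simp

lemma covered_two_states: "covered_all maps2 [two_states, two_states] []"
  by code_simp

lemma covered_one_state: "covered_all [] [one_state] []"
  by code_simp

text \<open>
  For an irreducible code the exhaustive check leaves membership in one of the two lists as the only
  possibility.
\<close>
lemma irreducible_covered:
  assumes A: "valid_code A" "A \<noteq> []" "length A \<le> 3" and irr: "\<not> reducible A"
  shows "A \<in> set representatives \<union> set merged_codes"
proof -
  have table: "A \<in> set representatives \<union> set merged_codes"
    if "covered fs A" "\<forall>(f, js)\<in>set fs. js \<noteq> [] \<and> set f = {1..int (length js)}" for fs
  proof (rule ccontr)
    assume "\<not> ?thesis"
    then have "reduces fs A" using that(1) by (auto simp: covered_def member_iff split: if_splits)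
    then show False using reducesD[OF _ that(2) A(1)] irr by (auto simp: reducible_def)
  qed
  have set2: "{1..2 :: int} = {1, 2}" and set3: "{1..3 :: int} = {1, 2, 3}" by auto
  consider p where "A = [p]" | p q where "A = [p, q]" | p q r where "A = [p, q, r]"
    using A(2,3) by (cases A; cases "tl A"; cases "tl (tl A)"; cases "tl (tl (tl A))") auto
  then show ?thesis
  proof cases
    case (1 p)
    have "p \<in> set one_state" using A(1) 1 by (cases p) (auto simp: valid_code_def one_state_def)
    then have "covered [] A" using covered_one_state 1 by (auto simp: covered_all_Cons)
    then show ?thesis by (rule table) simp
  next
    case (2 p q)
    have "p \<in> set two_states" "q \<in> set two_states"
      using A(1) 2 by (cases p; cases q; auto simp: valid_code_def two_states_def set2)+
    then have "covered maps2 A" using covered_two_states 2 by (auto simp: covered_all_Cons)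
    then show ?thesis by (rule table) (auto simp: maps2_def)
  next
    case (3 p q r)
    obtain l1 r1 s1 l2 r2 s2 l3 r3 s3 where pqr: "p = (l1, r1, s1)" "q = (l2, r2, s2)" "r = (l3, r3, s3)"
      by (metis prod_cases3)
    have mem: "l1 \<in> {1..3}" "r1 \<in> {1..3}" "l2 \<in> {1..3}" "r2 \<in> {1..3}" "l3 \<in> {1..3}" "r3 \<in> {1..3}"
      using A(1) 3 pqr by (simp_all add: valid_code_def)
    have s: "s1" "\<not> s3" "r3 \<le> l3" "if s2 then r2 \<le> l2 else r1 \<le> l1"
      using irreducible_three_states[of l1 r1 s1 l2 r2 s2 l3 r3 s3] A(1) irr 3 pqr by auto
    have any: "(l, r, True) \<in> set activated" "(l, r, False) \<in> set inactive"
      if "l \<in> {1..3}" "r \<in> {1..3}" for l r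
      using that by (auto simp: set3 activated_def inactive_def)
    have sorted: "(l, r, True) \<in> set activated_sorted" "(l, r, False) \<in> set inactive_sorted"
      if "l \<in> {1..3}" "r \<in> {1..3}" "r \<le> l" for l r
      using that by (auto simp: set3 activated_sorted_def inactive_sorted_def)
    have "covered maps3 A"
    proof (cases s2)
      case True
      then have "p \<in> set activated" "q \<in> set activated_sorted" "r \<in> set inactive_sorted"
        using s any sorted mem pqr by simp_all
      then show ?thesis using covered_two_active 3 by (auto simp: covered_all_Cons)
    next
      case False
      then have "p \<in> set activated_sorted" "q \<in> set inactive" "r \<in> set inactive_sorted"
        using s any sorted mem pqr by simp_all
      then show ?thesis using covered_one_active 3 by (auto simp: covered_all_Cons)
    qed
    then show ?thesis by (rule table) (auto simp: maps3_def)
  qed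
qed

lemma representatives_cover:
  assumes "valid_code A" "A \<noteq> []" "length A \<le> 3"
  shows "\<exists>B\<in>set representatives. code_group A \<cong> code_group B"
proof -
  have "wf (inv_image (lenlex less_than) (\<lambda>A. map nat (key A)))"
    by (intro wf_inv_image wf_lenlex wf_less_than)
  then show ?thesis
    using assms
  proof (induction A rule: wf_induct_rule)
    case (less A)
    show ?case
    proof (cases "reducible A")
      case True
      then obtain B where B: "valid_code B" "B \<noteq> []" "code_group A \<cong> code_group B"
        "length B \<le> length A" "(map nat (key B), map nat (key A)) \<in> lenlex less_than"
        by (auto simp: reducible_def)
      then obtain C where "C \<in> set representatives" "code_group B \<cong> code_group C"
        using less.IH[of B] less.prems by (auto simp: in_inv_image)
      then show ?thesis using B(3) iso_trans by blast
    next
      case False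
      then show ?thesis
        using irreducible_covered[OF less.prems] representatives_cover_table by blast
    qed
  qed
qed

section \<open>The bound\<close>

theorem theorem2:
  fixes \<G> :: "('x list \<Rightarrow> 'x list) monoid set"
  assumes "\<G> = {automaton_group A | A :: ('q, 'x) automaton.
                  invertible_automaton A \<and> card (states A) = 3 \<and> card (alphabet A) = 2}"
  shows "finite (iso_classes \<G>) \<and> card (iso_classes \<G>) \<le> 124"
proof -
  define K where "K B = {H \<in> \<G>. H \<cong> code_group B}" for B
  have group: "group G" if "G \<in> \<G>" for G
    using that group_automaton_group by (auto simp: assms)
  have "iso_classes \<G> \<subseteq> K ` set representatives"
  proof
    fix c assume "c \<in> iso_classes \<G>"
    then obtain G where G: "G \<in> \<G>" "c = iso_rel \<G> `` {G}"
      by (auto simp: iso_classes_def quotient_def)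
    then obtain C where "valid_code C" "length C = 3" "G \<cong> code_group C"
      using automaton_group_code assms by blast
    moreover from this obtain B where "B \<in> set representatives" "code_group C \<cong> code_group B"
      using representatives_cover[of C] by fastforce
    ultimately have B: "B \<in> set representatives" "G \<cong> code_group B"
      using iso_trans by blast+
    have "G \<cong> H \<longleftrightarrow> H \<cong> code_group B" if "H \<in> \<G>" for H
      using B(2) group[OF G(1)] group[OF that] group.iso_sym iso_trans
      by (metis code_group_def group_wgroup)
    then have "c = K B" using G by (auto simp: K_def iso_rel_def)
    then show "c \<in> K ` set representatives" using B(1) by blast
  qed
  moreover have "card (K ` set representatives) \<le> 124"
  proof -
    have "card (K ` set representatives) \<le> length representatives"
      by (meson card_image_le card_length finite_set le_trans)
    also have "length representatives = 124" by (simp add: representatives_def)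
    finally show ?thesis .
  qed
  ultimately show ?thesis
    by (meson card_mono finite_imageI finite_set finite_subset le_trans)
qed

end
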